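(* Let $V$ be a vector configuration of rank $r$ containing no copy of the zero vector, and suppose $\mathrm{DD}(V)\le 2$. Then $V$ admits a codegree$^*$ decomposition of length at least $r-\mathrm{DD}(V)$.
   Context: A vector configuration is a finite family (repetitions allowed) $V$ of vectors in $\mathbb{R}^r$; a subconfiguration is a subfamily, $\operatorname{rank}(V)=\dim\operatorname{lin}(V)$, and cardinalities count multiplicities. For a nonzero linear functional $f$, the oriented linear hyperplane $H=\{f=0\}$ has $\overline{H}^-=\{f\le0\}$. The dual codegree of a (sub)configuration $W$ is $\operatorname{codeg}^*(W)=\min_H|\overline{H}^-\cap W|$ over oriented linear hyperplanes $H$. The covector discrepancy is $\mathrm{DD}(W)=\max_f\big|\,|\{w\in W: f(w)>0\}|-|\{w\in W:f(w)<0\}|\,\big|$ over all linear functionals $f$. A codegree$^*$ decomposition of $V$ of length $m$ is a partition $V=V_0\uplus V_1\uplus\dots\uplus V_m$ into subconfigurations ($V_0$ possibly empty) such that $\operatorname{codeg}^*(V)=\sum_{i=1}^m\operatorname{codeg}^*(V_i)$ and $\operatorname{codeg}^*(V_i)\ge1$ for $1\le i\le m$. *)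

theory Defs
  imports "HOL-Analysis.Analysis"
begin

text \<open>A vector configuration is a finite index set I with a map v : I -> 'a;
  repetitions are allowed since v need not be injective.  A subconfiguration
  is given by a subset W of I.\<close>

definition codeg_star :: "('i \<Rightarrow> 'a::euclidean_space) \<Rightarrow> 'i set \<Rightarrow> nat" where
  "codeg_star v W =
     Min ((\<lambda>f. card {i \<in> W. f (v i) \<le> (0::real)}) ` {f. linear f \<and> f \<noteq> (\<lambda>x. 0)})"

definition covector_discrepancy :: "('i \<Rightarrow> 'a::euclidean_space) \<Rightarrow> 'i set \<Rightarrow> nat" where
  "covector_discrepancy v W =
     Max ((\<lambda>f. nat \<bar>int (card {i \<in> W. f (v i) > (0::real)})
                    - int (card {i \<in> W. f (v i) < 0})\<bar>) ` {f. linear f})"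

definition rank_conf :: "('i \<Rightarrow> 'a::euclidean_space) \<Rightarrow> 'i set \<Rightarrow> nat" where
  "rank_conf v W = dim (span (v ` W))"

definition codeg_star_decomposition ::
  "('i \<Rightarrow> 'a::euclidean_space) \<Rightarrow> 'i set \<Rightarrow> (nat \<Rightarrow> 'i set) \<Rightarrow> nat \<Rightarrow> bool" where
  "codeg_star_decomposition v I Vs m \<longleftrightarrow>
     (\<forall>k\<le>m. Vs k \<subseteq> I) \<and>
     (\<Union>k\<le>m. Vs k) = I \<and>
     (\<forall>k\<le>m. \<forall>l\<le>m. k \<noteq> l \<longrightarrow> Vs k \<inter> Vs l = {}) \<and>
     codeg_star v I = (\<Sum>k=1..m. codeg_star v (Vs k)) \<and>
     (\<forall>k\<in>{1..m}. codeg_star v (Vs k) \<ge> 1)"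

end

theory Submission
  imports Defs
begin

text \<open>
  For a configuration without zero vectors the number of vectors is twice the dual codegree plus the
  covector discrepancy, so a decomposition is a partition in which discrepancies add up. Antipodal
  pairs have discrepancy \<open>0\<close> and can be split off one by one, each lowering the rank by at most one.
  It remains to treat antipodal-free configurations.

  View the vectors as signed points of a projective space, and call a flat odd or even according to
  the number of vectors on it. The discrepancy has the parity of the number of vectors, so with
  discrepancy at most \<open>2\<close> an odd flat has discrepancy \<open>1\<close>. Two adjacent points of a line force its
  discrepancy to be at least \<open>2\<close>; hence there are no adjacent points if the discrepancy is at most
  \<open>1\<close>, and a smallest triangle shows that the rank is at most \<open>2\<close>.

  Let the discrepancy be \<open>2\<close> and the rank at least \<open>4\<close>; in rank at most \<open>3\<close> one part suffices.
  Contracting flats shows that planes are even, that there is an odd line \<open>L\<close>, and that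
  in a plane through \<open>L\<close> every point is on exactly one even line unless all its lines are even.
  Comparing signs on neighbouring lines of a pencil, every plane through \<open>L\<close> contains exactly one
  vector off \<open>L\<close>, so every point of \<open>L\<close> is joined to all vectors off \<open>L\<close> by even lines. This bounds
  their rank by \<open>2\<close>: the spans of \<open>L\<close> and of its complement form a direct sum, and discrepancies add
  up on direct sums.
\<close>

section \<open>Flats\<close>

definition flat :: "('i \<Rightarrow> 'a::euclidean_space) \<Rightarrow> 'i set \<Rightarrow> 'i set \<Rightarrow> 'i set" where
  "flat v W A = {i \<in> W. v i \<in> span (v ` A)}"

lemma mem_flat: "i \<in> flat v W A \<longleftrightarrow> i \<in> W \<and> v i \<in> span (v ` A)"
  by (simp add: flat_def)

lemma flat_subset: "flat v W A \<subseteq> W"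
  by (auto simp: flat_def)

lemma finite_flat [simp]: "finite W \<Longrightarrow> finite (flat v W A)"
  by (simp add: flat_def)

lemma subset_flat: "A \<subseteq> W \<Longrightarrow> A \<subseteq> flat v W A"
  by (auto simp: flat_def span_base)

lemma flat_mono: "A \<subseteq> B \<Longrightarrow> flat v W A \<subseteq> flat v W B"
  using span_mono[of "v ` A" "v ` B"] by (auto simp: flat_def)

lemma flat_minimal: "A \<subseteq> flat v W B \<Longrightarrow> flat v W A \<subseteq> flat v W B"
  using span_minimal[of "v ` A" "span (v ` B)"] by (auto simp: flat_def)

lemma flat_of_flat: "A \<subseteq> flat v W B \<Longrightarrow> flat v (flat v W B) A = flat v W A"
  using flat_minimal[of A v W B] by (auto simp: flat_def)

lemma flat_exchange:
  assumes "i \<in> flat v W (insert j A)" "i \<notin> flat v W A"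
  shows "flat v W (insert i A) = flat v W (insert j A)"
proof -
  have "v i \<in> span (insert (v j) (v ` A))" "v i \<notin> span (v ` A)"
    using assms by (auto simp: mem_flat)
  moreover from this have "v j \<in> span (insert (v i) (v ` A))"
    by (rule in_span_insert)
  ultimately have "span (insert (v i) (v ` A)) = span (insert (v j) (v ` A))"
    by (auto simp: span_eq span_base)
  then show ?thesis by (simp add: flat_def)
qed

lemma flat_singleton_eq:
  assumes "0 \<notin> v ` W" "j \<in> flat v W {i}"
  shows "flat v W {j} = flat v W {i}"
  using flat_exchange[of j v W i "{}"] assms by (force simp: mem_flat)

lemma dim_le_if_subset_flat:
  "K \<subseteq> flat v W A \<Longrightarrow> dim (v ` K) \<le> dim (v ` A)"
  using dim_subset[of "v ` K" "span (v ` A)"] by (auto simp: flat_def)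

lemma inner_eq_0_on_span:
  fixes u :: "'a::euclidean_space"
  shows "y \<in> span B \<Longrightarrow> (\<And>x. x \<in> B \<Longrightarrow> x \<bullet> u = 0) \<Longrightarrow> y \<bullet> u = 0"
  by (metis inner_commute orthogonal_def orthogonal_to_span)

lemma flat_annihilated:
  assumes "\<forall>k\<in>A. v k \<bullet> u = 0" "i \<in> flat v W A"
  shows "v i \<bullet> u = 0"
  using assms inner_eq_0_on_span[of "v i" "v ` A" u] by (auto simp: mem_flat)

lemma exists_annihilator:
  fixes x :: "'a::euclidean_space"
  assumes "x \<notin> span B"
  obtains u where "\<And>y. y \<in> span B \<Longrightarrow> y \<bullet> u = 0" "x \<bullet> u = 1"
proof -
  obtain y z where y: "y \<in> span B" and z: "\<And>w. w \<in> span B \<Longrightarrow> orthogonal z w" and "x = y + z"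
    using orthogonal_subspace_decomp_exists by metis
  then have "z \<noteq> 0" "x \<bullet> z = z \<bullet> z"
    using assms y z[OF y] by (auto simp: orthogonal_def inner_add_left inner_commute[of z y])
  with z that[of "(1 / (z \<bullet> z)) *\<^sub>R z"] show ?thesis
    by (simp add: orthogonal_def inner_commute)
qed

section \<open>Imbalance and covector discrepancy\<close>

definition isgn :: "real \<Rightarrow> int" where
  "isgn x = (if x > 0 then 1 else if x < 0 then - 1 else 0)"

definition imbalance :: "('i \<Rightarrow> 'a::euclidean_space) \<Rightarrow> 'i set \<Rightarrow> 'a \<Rightarrow> int" where
  "imbalance v W u = (\<Sum>i\<in>W. isgn (v i \<bullet> u))"

lemma isgn_simps [simp]:
  "isgn 0 = 0" "x > 0 \<Longrightarrow> isgn x = 1" "x < 0 \<Longrightarrow> isgn x = - 1"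
  "isgn (- x) = - isgn x" "isgn x = 0 \<longleftrightarrow> x = 0"
  by (auto simp: isgn_def)

lemma isgn_mult_pos: "c > 0 \<Longrightarrow> isgn (c * x) = isgn x"
  by (auto simp: isgn_def zero_less_mult_iff mult_less_0_iff)

lemma isgn_eq_of_bool_diff: "isgn x = of_bool (x > 0) - of_bool (x < 0)"
  by (simp add: isgn_def)

lemma imbalance_zero [simp]: "imbalance v W 0 = 0"
  by (simp add: imbalance_def)

lemma imbalance_uminus [simp]: "imbalance v W (- u) = - imbalance v W u"
  by (simp add: imbalance_def sum_negf)

lemma imbalance_Un:
  "finite A \<Longrightarrow> finite B \<Longrightarrow> A \<inter> B = {} \<Longrightarrow>
    imbalance v (A \<union> B) u = imbalance v A u + imbalance v B u"
  by (simp add: imbalance_def sum.union_disjoint)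

lemma imbalance_mono_neutral:
  "finite W \<Longrightarrow> K \<subseteq> W \<Longrightarrow> (\<And>i. i \<in> W - K \<Longrightarrow> v i \<bullet> u = 0) \<Longrightarrow> imbalance v W u = imbalance v K u"
  unfolding imbalance_def by (rule sum.mono_neutral_right) auto

lemma imbalance_eq_card_diff:
  assumes "finite W"
  shows "imbalance v W u = int (card {i \<in> W. v i \<bullet> u > 0}) - int (card {i \<in> W. v i \<bullet> u < 0})"
  using assms by (simp add: imbalance_def isgn_eq_of_bool_diff sum_subtractf sum_of_bool_eq Int_def)

lemma abs_imbalance_le_card: "finite W \<Longrightarrow> \<bar>imbalance v W u\<bar> \<le> int (card W)"
  using card_mono[of W "{i \<in> W. v i \<bullet> u > 0}"] card_mono[of W "{i \<in> W. v i \<bullet> u < 0}"]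
  by (simp add: imbalance_eq_card_diff)

lemma abs_imbalance_eq_card_if_same_sign:
  assumes "\<And>i. i \<in> W \<Longrightarrow> c * (v i \<bullet> u) > 0"
  shows "\<bar>imbalance v W u\<bar> = int (card W)"
proof (cases "W = {}")
  case False
  then have "c \<noteq> 0" using assms by auto
  have "isgn (v i \<bullet> u) = isgn c" if "i \<in> W" for i
    using assms[OF that] by (auto simp: isgn_def zero_less_mult_iff)
  then have "imbalance v W u = int (card W) * isgn c" by (simp add: imbalance_def)
  then show ?thesis using \<open>c \<noteq> 0\<close> by (auto simp: isgn_def)
qed (simp add: imbalance_def)

lemma exists_same_sign_if_balanced:
  assumes fin: "finite W" and balanced: "imbalance v W u = 0" and t: "t \<in> W" "v t \<bullet> u \<noteq> 0"
    and "c \<noteq> 0"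
  shows "\<exists>i\<in>W. c * (v i \<bullet> u) > 0"
proof -
  define P where "P = {i \<in> W. v i \<bullet> u > 0}"
  define N where "N = {i \<in> W. v i \<bullet> u < 0}"
  have "finite P" "finite N" "card P = card N"
    using fin balanced by (simp_all add: P_def N_def imbalance_eq_card_diff)
  moreover have "P \<noteq> {} \<or> N \<noteq> {}"
    using t by (auto simp: P_def N_def linorder_neq_iff)
  ultimately have "P \<noteq> {}" "N \<noteq> {}" by (metis card_0_eq)+
  then show ?thesis using \<open>c \<noteq> 0\<close> by (auto simp: P_def N_def zero_less_mult_iff linorder_neq_iff)
qed

lemma eventually_isgn_perturbation:
  fixes x u g :: "'a::euclidean_space"
  shows "eventually (\<lambda>e. isgn (x \<bullet> (u + e *\<^sub>R g)) =
    (if x \<bullet> u = 0 then isgn (x \<bullet> g) else isgn (x \<bullet> u))) (at_right 0)"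
proof -
  have limit: "((\<lambda>e. x \<bullet> (u + e *\<^sub>R g)) \<longlongrightarrow> x \<bullet> u) (at_right 0)"
    by (auto intro!: tendsto_eq_intros)
  consider "x \<bullet> u = 0" | "x \<bullet> u > 0" | "x \<bullet> u < 0" by linarith
  then show ?thesis
  proof cases
    assume "x \<bullet> u = 0"
    then show ?thesis
      using eventually_at_right_less[of 0]
      by (auto elim!: eventually_mono simp: inner_add_right isgn_mult_pos)
  next
    assume "x \<bullet> u > 0"
    then show ?thesis using order_tendstoD(1)[OF limit, of 0] by (auto elim!: eventually_mono)
  next
    assume "x \<bullet> u < 0"
    then show ?thesis using order_tendstoD(2)[OF limit, of 0] by (auto elim!: eventually_mono)
  qed
qed

lemma exists_perturbation:
  fixes v :: "'i \<Rightarrow> 'a::euclidean_space"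
  assumes fin: "finite W"
  obtains u' where "\<forall>x. x \<bullet> u = 0 \<longrightarrow> x \<bullet> g = 0 \<longrightarrow> x \<bullet> u' = 0"
    and "{i \<in> W. v i \<bullet> u' = 0} = {i \<in> W. v i \<bullet> u = 0 \<and> v i \<bullet> g = 0}"
    and "imbalance v W u' = imbalance v W u + imbalance v {i \<in> W. v i \<bullet> u = 0} g"
proof -
  have "eventually (\<lambda>e. \<forall>i\<in>W. isgn (v i \<bullet> (u + e *\<^sub>R g)) =
      (if v i \<bullet> u = 0 then isgn (v i \<bullet> g) else isgn (v i \<bullet> u))) (at_right 0)"
    by (intro eventually_ball_finite[OF fin] ballI eventually_isgn_perturbation)
  then obtain e where sign: "\<And>i. i \<in> W \<Longrightarrow> isgn (v i \<bullet> (u + e *\<^sub>R g)) =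
      (if v i \<bullet> u = 0 then isgn (v i \<bullet> g) else isgn (v i \<bullet> u))"
    using eventually_happens'[OF trivial_limit_at_right_real] by blast
  show ?thesis
  proof
    show "\<forall>x. x \<bullet> u = 0 \<longrightarrow> x \<bullet> g = 0 \<longrightarrow> x \<bullet> (u + e *\<^sub>R g) = 0"
      by (simp add: inner_add_right)
    show "{i \<in> W. v i \<bullet> (u + e *\<^sub>R g) = 0} = {i \<in> W. v i \<bullet> u = 0 \<and> v i \<bullet> g = 0}"
    proof (rule Collect_cong, rule conj_cong)
      show "v i \<bullet> (u + e *\<^sub>R g) = 0 \<longleftrightarrow> v i \<bullet> u = 0 \<and> v i \<bullet> g = 0" if "i \<in> W" for i
        using sign[OF that] isgn_simps(5) by (metis (no_types))
    qed simp
    have "imbalance v W (u + e *\<^sub>R g) =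
        (\<Sum>i\<in>W. isgn (v i \<bullet> u) + (if v i \<bullet> u = 0 then isgn (v i \<bullet> g) else 0))"
      unfolding imbalance_def by (rule sum.cong) (auto simp: sign)
    then show "imbalance v W (u + e *\<^sub>R g) = imbalance v W u + imbalance v {i \<in> W. v i \<bullet> u = 0} g"
      by (simp add: imbalance_def sum.distrib sum.inter_filter[OF fin])
  qed
qed

lemma exists_generic_annihilator:
  fixes v :: "'i \<Rightarrow> 'a::euclidean_space"
  assumes "finite W"
  shows "\<exists>u. (\<forall>k\<in>A. v k \<bullet> u = 0) \<and> {i \<in> W. v i \<bullet> u = 0} = flat v W A"
  using assms
proof (induction W rule: finite_induct)
  case empty
  show ?case by (rule exI[of _ 0]) (simp add: flat_def)
next
  case (insert k W)
  then obtain u where u: "\<forall>k\<in>A. v k \<bullet> u = 0" "{i \<in> W. v i \<bullet> u = 0} = flat v W A" by blast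
  show ?case
  proof (cases "v k \<in> span (v ` A)")
    case True
    then have "v k \<bullet> u = 0" using flat_annihilated[OF u(1), of k "{k}"] by (simp add: mem_flat)
    with True u have "{i \<in> insert k W. v i \<bullet> u = 0} = flat v (insert k W) A"
      by (auto simp: flat_def)
    with u(1) show ?thesis by blast
  next
    case False
    then obtain g where g: "\<And>y. y \<in> span (v ` A) \<Longrightarrow> y \<bullet> g = 0" "v k \<bullet> g = 1"
      using exists_annihilator by blast
    obtain u' where u': "\<forall>x. x \<bullet> u = 0 \<longrightarrow> x \<bullet> g = 0 \<longrightarrow> x \<bullet> u' = 0"
      "{i \<in> insert k W. v i \<bullet> u' = 0} = {i \<in> insert k W. v i \<bullet> u = 0 \<and> v i \<bullet> g = 0}"
      by (rule exists_perturbation[of "insert k W" u g v]) (use insert.hyps in auto)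
    have "{i \<in> insert k W. v i \<bullet> u' = 0} = flat v (insert k W) A"
      unfolding u'(2) using u(2) g False by (auto simp: flat_def)
    with u(1) g(1) u'(1) show ?thesis by (intro exI[of _ u']) (simp add: span_base)
  qed
qed

lemma exists_generic_imbalance_ge:
  assumes fin: "finite W" and u: "\<forall>k\<in>A. v k \<bullet> u = 0"
  obtains u' where "\<forall>k\<in>A. v k \<bullet> u' = 0" "{i \<in> W. v i \<bullet> u' = 0} = flat v W A"
    "\<bar>imbalance v W u\<bar> \<le> \<bar>imbalance v W u'\<bar>"
proof -
  let ?Z = "{i \<in> W. v i \<bullet> u = 0}"
  obtain g where g: "\<forall>k\<in>A. v k \<bullet> g = 0" "{i \<in> W. v i \<bullet> g = 0} = flat v W A"
    using exists_generic_annihilator[OF fin] by blast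
  define h where "h = (if imbalance v W u * imbalance v ?Z g \<ge> 0 then g else - g)"
  have h: "\<forall>k\<in>A. v k \<bullet> h = 0" "{i \<in> W. v i \<bullet> h = 0} = flat v W A" using g by (auto simp: h_def)
  have same_sign: "imbalance v W u * imbalance v ?Z h \<ge> 0" by (auto simp: h_def)
  obtain u' where u': "\<forall>x. x \<bullet> u = 0 \<longrightarrow> x \<bullet> h = 0 \<longrightarrow> x \<bullet> u' = 0"
    "{i \<in> W. v i \<bullet> u' = 0} = {i \<in> W. v i \<bullet> u = 0 \<and> v i \<bullet> h = 0}"
    "imbalance v W u' = imbalance v W u + imbalance v ?Z h"
    by (rule exists_perturbation[OF fin, of u h v])
  show ?thesis
  proof
    show "\<forall>k\<in>A. v k \<bullet> u' = 0" using u h(1) u'(1) by blast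
    show "{i \<in> W. v i \<bullet> u' = 0} = flat v W A"
      unfolding u'(2) using h(2) flat_annihilated[OF u, of _ W] by blast
    show "\<bar>imbalance v W u\<bar> \<le> \<bar>imbalance v W u'\<bar>"
      unfolding u'(3) using same_sign by (auto simp: zero_le_mult_iff)
  qed
qed

lemma linear_functional_iff_inner:
  fixes f :: "'a::euclidean_space \<Rightarrow> real"
  shows "linear f \<longleftrightarrow> (\<exists>u. f = (\<lambda>x. x \<bullet> u))"
proof
  assume "linear f"
  then have "f = (\<lambda>x. x \<bullet> adjoint f 1)" by (simp add: fun_eq_iff adjoint_works)
  then show "\<exists>u. f = (\<lambda>x. x \<bullet> u)" ..
qed (auto simp: bounded_linear.linear bounded_linear_inner_left)

lemma covector_discrepancy_eq_Max:
  fixes v :: "'i \<Rightarrow> 'a::euclidean_space"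
  assumes "finite W"
  shows "covector_discrepancy v W = Max (range (\<lambda>u. nat \<bar>imbalance v W u\<bar>))"
proof -
  have "{f::'a \<Rightarrow> real. linear f} = range (\<lambda>u x. x \<bullet> u)"
    by (auto simp: linear_functional_iff_inner)
  then show ?thesis
    by (simp add: covector_discrepancy_def imbalance_eq_card_diff[OF assms] image_image)
qed

lemma finite_abs_imbalances: "finite W \<Longrightarrow> finite (range (\<lambda>u. nat \<bar>imbalance v W u\<bar>))"
  by (rule finite_subset[of _ "{..card W}"])
    (use abs_imbalance_le_card[of W v] in \<open>auto simp: nat_le_iff\<close>)

lemma abs_imbalance_le_covector_discrepancy:
  assumes "finite W"
  shows "\<bar>imbalance v W u\<bar> \<le> int (covector_discrepancy v W)"
proof -
  have "nat \<bar>imbalance v W u\<bar> \<le> covector_discrepancy v W"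
    unfolding covector_discrepancy_eq_Max[OF assms]
    by (rule Max_ge[OF finite_abs_imbalances[OF assms]]) simp
  then show ?thesis by linarith
qed

lemma exists_imbalance_eq_covector_discrepancy:
  assumes "finite W"
  obtains u where "imbalance v W u = int (covector_discrepancy v W)"
proof -
  have "covector_discrepancy v W \<in> range (\<lambda>u. nat \<bar>imbalance v W u\<bar>)"
    unfolding covector_discrepancy_eq_Max[OF assms]
    by (rule Max_in[OF finite_abs_imbalances[OF assms]]) simp
  then obtain u where "covector_discrepancy v W = nat \<bar>imbalance v W u\<bar>" by blast
  then show ?thesis using that[of u] that[of "- u"] by (cases "imbalance v W u \<ge> 0") auto
qed

lemma covector_discrepancy_le_card:
  assumes "finite W"
  shows "covector_discrepancy v W \<le> card W"
proof -
  obtain u where "imbalance v W u = int (covector_discrepancy v W)"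
    using exists_imbalance_eq_covector_discrepancy[OF assms] .
  then show ?thesis using abs_imbalance_le_card[OF assms, of v u] by simp
qed

lemma covector_discrepancy_empty [simp]: "covector_discrepancy v {} = 0"
  using covector_discrepancy_le_card[of "{}" v] by simp

lemma covector_discrepancy_eqI:
  "finite W \<Longrightarrow> finite W' \<Longrightarrow> (\<And>u. imbalance v W u = imbalance v W' u) \<Longrightarrow>
    covector_discrepancy v W = covector_discrepancy v W'"
  by (simp add: covector_discrepancy_eq_Max)

lemma covector_discrepancy_Un_le:
  assumes "finite A" "finite B" "A \<inter> B = {}"
  shows "covector_discrepancy v (A \<union> B) \<le> covector_discrepancy v A + covector_discrepancy v B"
proof -
  obtain u where "imbalance v (A \<union> B) u = int (covector_discrepancy v (A \<union> B))"
    using exists_imbalance_eq_covector_discrepancy[of "A \<union> B" v] assms by blast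
  then show ?thesis
    using abs_imbalance_le_covector_discrepancy[of A v u]
      abs_imbalance_le_covector_discrepancy[of B v u]
      assms by (simp add: imbalance_Un)
qed

lemma abs_imbalance_add_covector_discrepancy_flat_le:
  assumes fin: "finite W" and u: "\<forall>k\<in>A. v k \<bullet> u = 0"
  shows "\<bar>imbalance v W u\<bar> + int (covector_discrepancy v (flat v W A))
    \<le> int (covector_discrepancy v W)"
proof -
  obtain u' where u': "\<forall>k\<in>A. v k \<bullet> u' = 0" "{i \<in> W. v i \<bullet> u' = 0} = flat v W A"
    "\<bar>imbalance v W u\<bar> \<le> \<bar>imbalance v W u'\<bar>"
    by (rule exists_generic_imbalance_ge[OF fin u])
  have perturbed: "\<bar>imbalance v W u' + imbalance v (flat v W A) g\<bar> \<le> int (covector_discrepancy v W)"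
    for g
  proof -
    obtain u'' where "imbalance v W u'' = imbalance v W u' + imbalance v {i \<in> W. v i \<bullet> u' = 0} g"
      by (rule exists_perturbation[OF fin, of u' g v], rule that)
    then show ?thesis using abs_imbalance_le_covector_discrepancy[OF fin, of v u''] u'(2) by simp
  qed
  obtain g where g: "imbalance v (flat v W A) g = int (covector_discrepancy v (flat v W A))"
    using exists_imbalance_eq_covector_discrepancy[OF finite_flat[OF fin]] by blast
  show ?thesis using perturbed[of g] perturbed[of "- g"] u'(3) unfolding imbalance_uminus g
    by linarith
qed

lemma covector_discrepancy_flat_le:
  "finite W \<Longrightarrow> covector_discrepancy v (flat v W A) \<le> covector_discrepancy v W"
  using abs_imbalance_add_covector_discrepancy_flat_le[of W A v 0] by simp

lemma exists_generic_imbalance_eq_covector_discrepancy: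
  fixes v :: "'i \<Rightarrow> 'a::euclidean_space"
  assumes fin: "finite W" and nonzero: "0 \<notin> v ` W"
  obtains u where "u \<noteq> 0" "\<And>i. i \<in> W \<Longrightarrow> v i \<bullet> u \<noteq> 0"
    "imbalance v W u = int (covector_discrepancy v W)"
proof (cases "W = {}")
  case True
  with that[of "SOME b. b \<in> Basis"] nonzero_Basis[OF SOME_Basis] show ?thesis
    by (simp add: imbalance_def)
next
  case False
  obtain u0 where u0: "imbalance v W u0 = int (covector_discrepancy v W)"
    using exists_imbalance_eq_covector_discrepancy[OF fin] .
  obtain u where u: "{i \<in> W. v i \<bullet> u = 0} = flat v W {}" "\<bar>imbalance v W u0\<bar> \<le> \<bar>imbalance v W u\<bar>"
    using exists_generic_imbalance_ge[OF fin, of "{}" v u0] by auto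
  have generic: "v i \<bullet> u \<noteq> 0" if "i \<in> W" for i
    using u(1) nonzero that by (force simp: flat_def)
  then have "u \<noteq> 0" using False by auto
  moreover have "\<bar>imbalance v W u\<bar> = int (covector_discrepancy v W)"
    using u(2) u0 abs_imbalance_le_covector_discrepancy[OF fin, of v u] by linarith
  ultimately show ?thesis
    using that[of u] that[of "- u"] generic by (cases "imbalance v W u \<ge> 0") auto
qed

lemma card_eq_codeg_star_covector_discrepancy:
  fixes v :: "'i \<Rightarrow> 'a::euclidean_space"
  assumes fin: "finite W" and nonzero: "0 \<notin> v ` W"
  shows "card W = 2 * codeg_star v W + covector_discrepancy v W"
proof -
  let ?codegs = "(\<lambda>f. card {i \<in> W. f (v i) \<le> (0::real)}) ` {f. linear f \<and> f \<noteq> (\<lambda>x. 0)}"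
  have split: "card W = card {i \<in> W. v i \<bullet> u > 0} + card {i \<in> W. v i \<bullet> u \<le> 0}" for u
    using card_Int_Diff[OF fin, of "{i. v i \<bullet> u > 0}"]
    by (simp add: Int_def set_diff_eq not_less)
  have lower: "card W \<le> 2 * card {i \<in> W. v i \<bullet> u \<le> 0} + covector_discrepancy v W" for u
  proof -
    have "card {i \<in> W. v i \<bullet> u < 0} \<le> card {i \<in> W. v i \<bullet> u \<le> 0}"
      by (rule card_mono) (use fin in auto)
    then show ?thesis
      using split[of u] imbalance_eq_card_diff[OF fin, of v u]
        abs_imbalance_le_covector_discrepancy[OF fin, of v u] by linarith
  qed
  obtain u where u: "u \<noteq> 0" "\<And>i. i \<in> W \<Longrightarrow> v i \<bullet> u \<noteq> 0"
    "imbalance v W u = int (covector_discrepancy v W)"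
    using exists_generic_imbalance_eq_covector_discrepancy[OF fin nonzero] by blast
  have "{i \<in> W. v i \<bullet> u < 0} = {i \<in> W. v i \<bullet> u \<le> 0}" using u(2) by force
  then have attained: "card W = 2 * card {i \<in> W. v i \<bullet> u \<le> 0} + covector_discrepancy v W"
    using split[of u] imbalance_eq_card_diff[OF fin, of v u] u(3) by simp
  have "codeg_star v W = card {i \<in> W. v i \<bullet> u \<le> 0}"
    unfolding codeg_star_def
  proof (rule Min_eqI)
    show "finite ?codegs"
      by (rule finite_subset[of _ "{..card W}"]) (use fin in \<open>auto intro: card_mono\<close>)
    show "card {i \<in> W. v i \<bullet> u \<le> 0} \<le> c" if "c \<in> ?codegs" for c
      using that attained lower by (auto simp: linear_functional_iff_inner)
    have "(\<lambda>x. x \<bullet> u) \<noteq> (\<lambda>x. 0)" using u(1) by (metis inner_eq_zero_iff)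
    then show "card {i \<in> W. v i \<bullet> u \<le> 0} \<in> ?codegs"
      by (intro image_eqI[of _ _ "\<lambda>x. x \<bullet> u"]) (auto simp: linear_functional_iff_inner)
  qed
  with attained show ?thesis by simp
qed

lemma even_covector_discrepancy_iff:
  "finite W \<Longrightarrow> 0 \<notin> v ` W \<Longrightarrow> even (covector_discrepancy v W) \<longleftrightarrow> even (card W)"
  by (simp add: card_eq_codeg_star_covector_discrepancy)

lemma codeg_star_Un:
  assumes "finite A" "finite B" "A \<inter> B = {}" "0 \<notin> v ` (A \<union> B)"
    and "covector_discrepancy v (A \<union> B) = covector_discrepancy v A + covector_discrepancy v B"
  shows "codeg_star v (A \<union> B) = codeg_star v A + codeg_star v B"
  using card_eq_codeg_star_covector_discrepancy[of "A \<union> B" v]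
    card_eq_codeg_star_covector_discrepancy[of A v]
    card_eq_codeg_star_covector_discrepancy[of B v] card_Un_disjoint[of A B] assms
  by (simp add: image_Un)

section \<open>Contractions and direct sums\<close>

lemma exists_linear_kernel_span:
  fixes S :: "'a::euclidean_space set"
  obtains Q :: "'a \<Rightarrow> 'a" where "linear Q" "\<forall>x. Q x = 0 \<longleftrightarrow> x \<in> span S"
proof -
  obtain T where T: "pairwise orthogonal T" "span T = span S"
    using orthogonal_basis_subspace[OF subspace_span[of S]] by metis
  define P where "P x = (\<Sum>b\<in>T. (b \<bullet> x / (b \<bullet> b)) *\<^sub>R b)" for x
  have P_span: "P x \<in> span S" for x
    unfolding P_def T(2)[symmetric] by (intro span_sum span_scale span_base)
  have orth: "orthogonal (x - P x) y" if "y \<in> span S" for x y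
    using Gram_Schmidt_step[OF T(1), of y x] that T(2) by (simp add: P_def orthogonal_commute)
  have "linear (\<lambda>x. x - P x)"
    by (rule linearI)
      (simp_all add: P_def inner_add_right add_divide_distrib scaleR_add_left sum.distrib
        scaleR_sum_right scaleR_diff_right)
  moreover have "x - P x = 0 \<longleftrightarrow> x \<in> span S" for x
  proof
    assume "x \<in> span S"
    then have "orthogonal (x - P x) (x - P x)" by (intro orth span_diff P_span)
    then show "x - P x = 0" by (simp add: orthogonal_self)
  qed (use P_span[of x] in simp)
  ultimately show ?thesis using that by blast
qed

lemma dim_Un_eq_dim_kernel_add_dim_image:
  fixes Q :: "'a::euclidean_space \<Rightarrow> 'a"
  assumes Q: "linear Q" "\<forall>x. Q x = 0 \<longleftrightarrow> x \<in> span B" and "finite S"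
  shows "dim (B \<union> S) = dim B + dim (Q ` S)"
  using \<open>finite S\<close>
proof (induction S rule: finite_induct)
  case (insert s S)
  have "s \<in> span (B \<union> S) \<longleftrightarrow> Q s \<in> span (Q ` S)"
  proof
    assume "s \<in> span (B \<union> S)"
    then obtain b y where "s = b + y" "b \<in> span B" "y \<in> span S" by (auto simp: span_Un)
    moreover from this have "Q b = 0" using Q(2) by blast
    ultimately show "Q s \<in> span (Q ` S)" using Q(1) by (simp add: linear_add linear_span_image)
  next
    assume "Q s \<in> span (Q ` S)"
    then obtain y where "y \<in> span S" "Q (s - y) = 0"
      by (auto simp: linear_span_image[OF Q(1)] linear_diff[OF Q(1)])
    then have "s = (s - y) + y" "s - y \<in> span B" using Q(2) by auto
    with \<open>y \<in> span S\<close> show "s \<in> span (B \<union> S)" unfolding span_Un by blast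
  qed
  with insert.IH show ?case by (simp add: dim_insert)
qed simp

lemma dim_Un_le:
  fixes B S :: "'a::euclidean_space set"
  assumes "finite S"
  shows "dim (B \<union> S) \<le> dim B + dim S"
proof -
  obtain Q :: "'a \<Rightarrow> 'a" where Q: "linear Q" "\<forall>x. Q x = 0 \<longleftrightarrow> x \<in> span B"
    by (rule exists_linear_kernel_span)
  then show ?thesis
    using dim_Un_eq_dim_kernel_add_dim_image[OF Q assms] dim_image_le[OF Q(1), of S] by linarith
qed

lemma covector_discrepancy_contraction:
  assumes fin: "finite W" and Q: "linear Q" "\<forall>x. Q x = 0 \<longleftrightarrow> x \<in> span (v ` A)"
  shows "covector_discrepancy (Q \<circ> v) (W - flat v W A) + covector_discrepancy v (flat v W A)
    \<le> covector_discrepancy v W"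
proof -
  obtain u where u: "imbalance (Q \<circ> v) (W - flat v W A) u =
      int (covector_discrepancy (Q \<circ> v) (W - flat v W A))"
    using exists_imbalance_eq_covector_discrepancy[of "W - flat v W A" "Q \<circ> v"] fin by auto
  have adjoint_u: "x \<bullet> adjoint Q u = Q x \<bullet> u" for x
    by (simp add: adjoint_works[OF Q(1)])
  have kernel: "v i \<bullet> adjoint Q u = 0" if "v i \<in> span (v ` A)" for i
    using that Q(2) by (metis adjoint_u inner_zero_left)
  have "imbalance v W (adjoint Q u) = imbalance v (W - flat v W A) (adjoint Q u)"
    by (rule imbalance_mono_neutral[OF fin]) (auto simp: mem_flat intro: kernel)
  then have "imbalance v W (adjoint Q u) = imbalance (Q \<circ> v) (W - flat v W A) u"
    by (simp add: imbalance_def adjoint_u)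
  moreover have "\<forall>k\<in>A. v k \<bullet> adjoint Q u = 0"
    by (simp add: kernel span_base)
  ultimately show ?thesis
    using abs_imbalance_add_covector_discrepancy_flat_le[OF fin, of A v "adjoint Q u"] u by simp
qed

lemma flat_contraction:
  assumes Q: "linear Q" "\<forall>x. Q x = 0 \<longleftrightarrow> x \<in> span (v ` A)"
  shows "flat (Q \<circ> v) (W - flat v W A) {i} = flat v W (insert i A) - flat v W A"
proof -
  have "Q x \<in> span {Q (v i)} \<longleftrightarrow> x \<in> span (insert (v i) (v ` A))" for x
    unfolding span_breakdown_eq span_empty Q(2)[rule_format, symmetric]
    by (simp add: linear_diff[OF Q(1)] linear_scale[OF Q(1)])
  then show ?thesis by (auto simp: flat_def)
qed

lemma exists_common_functional:
  fixes S T :: "'a::euclidean_space set"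
  assumes direct: "dim S + dim T \<le> dim (S \<union> T)"
  obtains w where "\<And>x. x \<in> S \<Longrightarrow> x \<bullet> w = x \<bullet> u" "\<And>x. x \<in> T \<Longrightarrow> x \<bullet> w = x \<bullet> g"
proof -
  obtain B where B: "B \<subseteq> S" "independent B" "S \<subseteq> span B" "card B = dim S"
    using basis_exists by blast
  obtain C where C: "C \<subseteq> T" "independent C" "T \<subseteq> span C" "card C = dim T"
    using basis_exists by blast
  have fins: "finite B" "finite C" using B(2) C(2) independent_imp_finite by auto
  have spanning: "S \<union> T \<subseteq> span (B \<union> C)"
    using B(3) C(3) span_mono[of B "B \<union> C"] span_mono[of C "B \<union> C"] by blast
  have "dim S + dim T \<le> card (B \<union> C)"
    using direct dim_le_card[OF spanning finite_UnI[OF fins]] by linarith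
  then have "B \<inter> C = {}" and card_BC: "card (B \<union> C) = dim S + dim T"
    using card_Un_Int[OF fins] B(4) C(4) fins by auto
  have "independent (B \<union> C)"
    by (rule card_le_dim_spanning[OF _ spanning]) (use B(1) C(1) fins direct card_BC in auto)
  then obtain f :: "'a \<Rightarrow> real"
    where f: "linear f" "\<forall>x\<in>B \<union> C. f x = (if x \<in> B then x \<bullet> u else x \<bullet> g)"
    using linear_independent_extend[of "B \<union> C" "\<lambda>x. if x \<in> B then x \<bullet> u else x \<bullet> g"] by blast
  then obtain w where w: "f = (\<lambda>x. x \<bullet> w)" by (auto simp: linear_functional_iff_inner)
  have "b \<bullet> (w - u) = 0" if "b \<in> B" for b
    using f(2) that by (simp add: w inner_diff_right)
  then have "x \<bullet> (w - u) = 0" if "x \<in> S" for x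
    using inner_eq_0_on_span[of x B] B(3) that by blast
  moreover have "c \<bullet> (w - g) = 0" if "c \<in> C" for c
    using f(2) that \<open>B \<inter> C = {}\<close> by (auto simp: w inner_diff_right)
  then have "x \<bullet> (w - g) = 0" if "x \<in> T" for x
    using inner_eq_0_on_span[of x C] C(3) that by blast
  ultimately show ?thesis using that[of w] by (simp add: inner_diff_right)
qed

lemma covector_discrepancy_Un_direct:
  fixes v :: "'i \<Rightarrow> 'a::euclidean_space"
  assumes fins: "finite A" "finite B" and disjoint: "A \<inter> B = {}"
    and direct: "dim (v ` A) + dim (v ` B) \<le> dim (v ` (A \<union> B))"
  shows "covector_discrepancy v (A \<union> B) = covector_discrepancy v A + covector_discrepancy v B"
proof (rule antisym[OF covector_discrepancy_Un_le[OF fins disjoint]])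
  obtain u where u: "imbalance v A u = int (covector_discrepancy v A)"
    using exists_imbalance_eq_covector_discrepancy[OF fins(1)] .
  obtain g where g: "imbalance v B g = int (covector_discrepancy v B)"
    using exists_imbalance_eq_covector_discrepancy[OF fins(2)] .
  obtain w where w: "\<And>x. x \<in> v ` A \<Longrightarrow> x \<bullet> w = x \<bullet> u" "\<And>x. x \<in> v ` B \<Longrightarrow> x \<bullet> w = x \<bullet> g"
    using exists_common_functional direct unfolding image_Un by blast
  have "imbalance v A w = imbalance v A u" "imbalance v B w = imbalance v B g"
    by (simp_all add: imbalance_def w cong: sum.cong)
  then have "imbalance v (A \<union> B) w = int (covector_discrepancy v A + covector_discrepancy v B)"
    using u g by (simp add: imbalance_Un fins disjoint)
  then show "covector_discrepancy v A + covector_discrepancy v B \<le> covector_discrepancy v (A \<union> B)"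
    using abs_imbalance_le_covector_discrepancy[of "A \<union> B" v w] fins by simp
qed

section \<open>Antipodal pairs\<close>

definition antipodal :: "('i \<Rightarrow> 'a::euclidean_space) \<Rightarrow> 'i \<Rightarrow> 'i \<Rightarrow> bool" where
  "antipodal v i j \<longleftrightarrow> (\<exists>t>0. v j = - (t *\<^sub>R v i))"

definition antipodal_free :: "('i \<Rightarrow> 'a::euclidean_space) \<Rightarrow> 'i set \<Rightarrow> bool" where
  "antipodal_free v W \<longleftrightarrow> 0 \<notin> v ` W \<and> (\<forall>i\<in>W. \<forall>j\<in>W. \<not> antipodal v i j)"

lemma antipodal_free_subset: "antipodal_free v W \<Longrightarrow> K \<subseteq> W \<Longrightarrow> antipodal_free v K"
  by (auto simp: antipodal_free_def)

lemma antipodal_free_pos: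
  assumes "antipodal_free v W" "i \<in> W" "j \<in> W" "v j = t *\<^sub>R v i"
  shows "t > 0"
proof -
  have "t \<noteq> 0" using assms by (force simp: antipodal_free_def)
  moreover have "\<not> t < 0"
  proof
    assume "t < 0"
    then have "antipodal v i j" using assms(4) by (auto simp: antipodal_def intro!: exI[of _ "- t"])
    then show False using assms by (auto simp: antipodal_free_def)
  qed
  ultimately show ?thesis by linarith
qed

lemma antipodal_imp_neq:
  assumes "antipodal v i j" "v i \<noteq> 0"
  shows "i \<noteq> j"
proof
  assume "i = j"
  then obtain t where "t > 0" "(1 + t) *\<^sub>R v i = 0"
    using assms(1) by (auto simp: antipodal_def scaleR_left_distrib eq_neg_iff_add_eq_0)
  then show False using assms(2) by simp
qed

lemma antipodal_pair_induct [consumes 2, case_names antipodal_free antipodal_pair]: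
  assumes "finite W" "0 \<notin> v ` W"
    and "\<And>W. finite W \<Longrightarrow> antipodal_free v W \<Longrightarrow> P W"
    and "\<And>W i j. finite W \<Longrightarrow> 0 \<notin> v ` insert i (insert j W) \<Longrightarrow> i \<notin> W \<Longrightarrow> j \<notin> W \<Longrightarrow>
      antipodal v i j \<Longrightarrow> P W \<Longrightarrow> P (insert i (insert j W))"
  shows "P W"
  using assms(1,2)
proof (induction W rule: finite_psubset_induct)
  case (psubset W)
  show ?case
  proof (cases "antipodal_free v W")
    case True
    with assms(3) psubset.hyps show ?thesis by blast
  next
    case False
    then obtain i j where ij: "i \<in> W" "j \<in> W" "antipodal v i j"
      using psubset.prems by (auto simp: antipodal_free_def)
    then have W: "W = insert i (insert j (W - {i, j}))" by blast
    have "P (W - {i, j})" using psubset.IH[of "W - {i, j}"] psubset.prems ij by blast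
    then have "P (insert i (insert j (W - {i, j})))"
      by (intro assms(4)) (use psubset.hyps psubset.prems ij W in auto)
    with W show ?thesis by simp
  qed
qed

lemma imbalance_insert_antipodal_pair:
  assumes "finite W" "0 \<notin> v ` insert i (insert j W)" "i \<notin> W" "j \<notin> W" "antipodal v i j"
  shows "imbalance v (insert i (insert j W)) u = imbalance v W u"
proof -
  obtain t where "t > 0" "v j = - (t *\<^sub>R v i)" using assms(5) by (auto simp: antipodal_def)
  then have "isgn (v i \<bullet> u) + isgn (v j \<bullet> u) = 0" by (simp add: isgn_mult_pos)
  moreover have "i \<noteq> j" using antipodal_imp_neq assms(2,5) by force
  ultimately show ?thesis using assms(1,3,4) by (simp add: imbalance_def)
qed

lemma covector_discrepancy_insert_antipodal_pair:
  assumes "finite W" "0 \<notin> v ` insert i (insert j W)" "i \<notin> W" "j \<notin> W" "antipodal v i j"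
  shows "covector_discrepancy v (insert i (insert j W)) = covector_discrepancy v W"
  using assms by (intro covector_discrepancy_eqI imbalance_insert_antipodal_pair) auto

lemma even_card_flat_insert_antipodal_pair:
  assumes "finite W" "0 \<notin> v ` insert i (insert j W)" "i \<notin> W" "j \<notin> W" and anti: "antipodal v i j"
  shows "even (card (flat v (insert i (insert j W)) A)) \<longleftrightarrow> even (card (flat v W A))"
proof -
  obtain t where t: "t > 0" "v j = - (t *\<^sub>R v i)" using anti by (auto simp: antipodal_def)
  then have "v i = (- (1 / t)) *\<^sub>R v j" by simp
  then have parallel: "v j \<in> span (v ` A) \<longleftrightarrow> v i \<in> span (v ` A)"
    using t(2) by (metis span_neg span_scale)
  have "i \<noteq> j" using antipodal_imp_neq anti assms(2) by force
  show ?thesis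
  proof (cases "v i \<in> span (v ` A)")
    case True
    then have "flat v (insert i (insert j W)) A = insert i (insert j (flat v W A))"
      using parallel by (auto simp: flat_def)
    then show ?thesis using assms(1,3,4) \<open>i \<noteq> j\<close> by (simp add: mem_flat)
  next
    case False
    then have "flat v (insert i (insert j W)) A = flat v W A"
      using parallel by (auto simp: flat_def)
    then show ?thesis by simp
  qed
qed

lemma exists_antipodal_free_reduction:
  assumes "finite W" "0 \<notin> v ` W"
  shows "\<exists>K\<subseteq>W. antipodal_free v K \<and> covector_discrepancy v K = covector_discrepancy v W \<and>
    (\<forall>A. even (card (flat v K A)) \<longleftrightarrow> even (card (flat v W A)))"
  using assms
proof (induction rule: antipodal_pair_induct)
  case (antipodal_pair W i j)
  then obtain K where "K \<subseteq> W" "antipodal_free v K"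
    "covector_discrepancy v K = covector_discrepancy v W"
    "\<forall>A. even (card (flat v K A)) \<longleftrightarrow> even (card (flat v W A))" by blast
  with antipodal_pair.hyps show ?case
    by (intro exI[of _ K])
      (simp add: covector_discrepancy_insert_antipodal_pair even_card_flat_insert_antipodal_pair
        subset_insertI2)
qed blast

lemma covector_discrepancy_point:
  assumes "finite W" "antipodal_free v W" "x \<in> W"
  shows "covector_discrepancy v (flat v W {x}) = card (flat v W {x})"
proof -
  have "1 * (v i \<bullet> v x) > 0" if i: "i \<in> flat v W {x}" for i
  proof -
    obtain t where "v i = t *\<^sub>R v x" "i \<in> W" using i by (auto simp: mem_flat span_singleton)
    moreover from this have "t > 0" using antipodal_free_pos[OF assms(2,3)] by blast
    moreover have "v x \<noteq> 0" using assms(2,3) by (force simp: antipodal_free_def)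
    ultimately show ?thesis by simp
  qed
  then have "\<bar>imbalance v (flat v W {x}) (v x)\<bar> = int (card (flat v W {x}))"
    by (rule abs_imbalance_eq_card_if_same_sign)
  then have "card (flat v W {x}) \<le> covector_discrepancy v (flat v W {x})"
    using abs_imbalance_le_covector_discrepancy[of "flat v W {x}" v "v x"] assms(1) by simp
  then show ?thesis using covector_discrepancy_le_card[of "flat v W {x}" v] assms(1) by simp
qed

lemma card_point_pos:
  assumes "finite W" "x \<in> W"
  shows "card (flat v W {x}) > 0"
  using assms subset_flat[of "{x}" W v] by (auto simp: card_gt_0_iff)

section \<open>Adjacent points\<close>

lemma triangle_subdivide:
  fixes a b c k :: "'a::euclidean_space"
  assumes noncollinear: "\<not> collinear {a, b, c}" and k: "k \<in> open_segment a b"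
  shows "\<not> collinear {a, k, c}" "convex hull {a, k, c} \<subseteq> convex hull {a, b, c}"
    "b \<notin> convex hull {a, k, c}"
proof -
  have "k \<noteq> a" "k \<noteq> b" "k \<in> convex hull {a, b}"
    using k by (auto simp: open_segment_def segment_convex_hull)
  moreover have "collinear {b, a, k}"
    using k collinear_subset[OF collinear_closed_segment[of a b]] by (auto simp: open_segment_def)
  ultimately show "\<not> collinear {a, k, c}"
    using noncollinear collinear_3_trans[of b a k c] by (metis insert_commute)
  show hull_subset: "convex hull {a, k, c} \<subseteq> convex hull {a, b, c}"
    using \<open>k \<in> convex hull {a, b}\<close> hull_mono[of "{a, b}" "{a, b, c}" convex]
    by (intro hull_minimal) (auto simp: hull_inc)
  have extreme: "b extreme_point_of (convex hull {a, b, c})"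
    using noncollinear
    by (simp add: collinear_3_eq_affine_dependent extreme_point_of_convex_hull_affine_independent)
  show "b \<notin> convex hull {a, k, c}"
  proof
    assume "b \<in> convex hull {a, k, c}"
    then have "b extreme_point_of (convex hull {a, k, c})"
      using extreme hull_subset by (auto simp: extreme_point_of_def)
    then have "b \<in> {a, k, c}" by (rule extreme_point_of_convex_hull)
    then show False using noncollinear \<open>k \<noteq> b\<close> by (auto simp: collinear_3_eq_affine_dependent)
  qed
qed

lemma exists_noncollinear_triple:
  fixes S :: "'a::euclidean_space set"
  assumes noncollinear: "\<not> collinear S"
  obtains x y z where "x \<in> S" "y \<in> S" "z \<in> S" "\<not> collinear {x, y, z}"
proof -
  obtain x where "x \<in> S" using noncollinear by fastforce
  moreover have "\<not> S \<subseteq> {x}" using noncollinear collinear_subset[OF collinear_sing[of x]] by blast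
  then obtain y where "y \<in> S" "x \<noteq> y" by blast
  moreover from calculation have "insert x (insert y S) = S" by blast
  then have "\<not> (\<forall>z\<in>S. collinear {x, y, z})"
    using noncollinear collinear_triples[OF \<open>x \<noteq> y\<close>, of S] by argo
  then obtain z where "z \<in> S" "\<not> collinear {x, y, z}" by blast
  ultimately show ?thesis using that by simp
qed

text \<open>In a nondegenerate triangle with as few points of the configuration as possible, two vertices
  have the same colour; a point between them cuts off a smaller triangle.\<close>

lemma collinear_if_monochromatic_segments_meet:
  fixes p :: "'i \<Rightarrow> 'a::euclidean_space" and colour :: "'i \<Rightarrow> bool"
  assumes fin: "finite X"
    and meets: "\<And>i j. i \<in> X \<Longrightarrow> j \<in> X \<Longrightarrow> p i \<noteq> p j \<Longrightarrow> colour i = colour j \<Longrightarrow>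
      \<exists>k\<in>X. p k \<in> open_segment (p i) (p j)"
  shows "collinear (p ` X)"
proof (rule ccontr)
  assume noncollinear: "\<not> collinear (p ` X)"
  define triangle where "triangle T \<longleftrightarrow>
    (\<exists>i\<in>X. \<exists>j\<in>X. \<exists>k\<in>X. T = {i, j, k} \<and> \<not> collinear {p i, p j, p k})" for T
  define inside where "inside T = {l \<in> X. p l \<in> convex hull (p ` T)}" for T
  obtain x y z where "x \<in> p ` X" "y \<in> p ` X" "z \<in> p ` X" "\<not> collinear {x, y, z}"
    using exists_noncollinear_triple[OF noncollinear] .
  then have "\<exists>T. triangle T" unfolding triangle_def by blast
  then obtain T where T: "triangle T" "\<And>T'. triangle T' \<Longrightarrow> card (inside T) \<le> card (inside T')"
    using ex_has_least_nat[of triangle _ "\<lambda>T. card (inside T)"] by blast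
  from T(1) obtain a b c where abc: "a \<in> X" "b \<in> X" "c \<in> X" "T = {a, b, c}" "colour a = colour b"
    and triangle: "\<not> collinear {p a, p b, p c}"
    unfolding triangle_def by (smt (verit) insert_commute)
  then have "p a \<noteq> p b" by auto
  then obtain k where k: "k \<in> X" "p k \<in> open_segment (p a) (p b)"
    using meets abc by blast
  note smaller = triangle_subdivide[OF triangle k(2)]
  have "inside {a, k, c} \<subset> inside T"
    using smaller(2,3) abc by (auto simp: inside_def hull_inc)
  moreover have "finite (inside T)" using fin by (simp add: inside_def)
  ultimately have "card (inside {a, k, c}) < card (inside T)" by (simp add: psubset_card_mono)
  moreover have "triangle {a, k, c}"
    using smaller(1) abc k(1) by (auto simp: triangle_def)
  ultimately show False using T(2) by (meson leD)
qed

lemma mem_span_pair_iff: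
  fixes a b :: "'a::real_vector"
  shows "z \<in> span {a, b} \<longleftrightarrow> (\<exists>\<alpha> \<beta>. z = \<alpha> *\<^sub>R a + \<beta> *\<^sub>R b)"
  by (simp add: span_breakdown_eq[of z a] span_singleton image_iff diff_eq_eq add.commute)

text \<open>Points are taken up to sign, so \<open>\<alpha>\<close> and \<open>\<beta>\<close> may both be negative.\<close>

definition adjacent :: "('i \<Rightarrow> 'a::euclidean_space) \<Rightarrow> 'i set \<Rightarrow> 'i \<Rightarrow> 'i \<Rightarrow> bool" where
  "adjacent v W a b \<longleftrightarrow> (\<forall>k\<in>W. \<forall>\<alpha> \<beta>. v k = \<alpha> *\<^sub>R v a + \<beta> *\<^sub>R v b \<longrightarrow> \<not> \<alpha> * \<beta> > 0)"

lemma adjacent_subset: "adjacent v W s t \<Longrightarrow> K \<subseteq> W \<Longrightarrow> adjacent v K s t"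
  by (auto simp: adjacent_def)

lemma between_in_open_segment:
  fixes x y z g :: "'a::euclidean_space"
  assumes z: "z = \<alpha> *\<^sub>R x + \<beta> *\<^sub>R y" and "\<alpha> * \<beta> > 0" and "(x \<bullet> g) * (y \<bullet> g) > 0"
    and distinct: "x /\<^sub>R (x \<bullet> g) \<noteq> y /\<^sub>R (y \<bullet> g)"
  shows "z /\<^sub>R (z \<bullet> g) \<in> open_segment (x /\<^sub>R (x \<bullet> g)) (y /\<^sub>R (y \<bullet> g))"
proof -
  define s where "s = \<alpha> * (x \<bullet> g)"
  define t where "t = \<beta> * (y \<bullet> g)"
  have "s * t = (\<alpha> * \<beta>) * ((x \<bullet> g) * (y \<bullet> g))" by (simp add: s_def t_def)
  then have st: "s * t > 0" using assms(2,3) by simp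
  then have u: "0 < t / (s + t)" "t / (s + t) < 1" "1 - t / (s + t) = s / (s + t)" "s + t \<noteq> 0"
    by (auto simp: zero_less_mult_iff divide_simps)
  let ?x = "x /\<^sub>R (x \<bullet> g)" and ?y = "y /\<^sub>R (y \<bullet> g)"
  have "x \<bullet> g \<noteq> 0" "y \<bullet> g \<noteq> 0" using assms(3) by auto
  then have "z = s *\<^sub>R ?x + t *\<^sub>R ?y" and zg: "z \<bullet> g = s + t"
    by (simp_all add: z s_def t_def inner_add_left mult.assoc)
  then have "z /\<^sub>R (z \<bullet> g) = inverse (s + t) *\<^sub>R (s *\<^sub>R ?x + t *\<^sub>R ?y)" by metis
  also have "\<dots> = (s / (s + t)) *\<^sub>R ?x + (t / (s + t)) *\<^sub>R ?y"
    by (simp add: scaleR_add_right divide_inverse mult.commute mult.left_commute)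
  also have "\<dots> = (1 - t / (s + t)) *\<^sub>R ?x + (t / (s + t)) *\<^sub>R ?y" by (simp only: u(3))
  finally show ?thesis using u(1,2) distinct by (auto simp: in_segment)
qed

lemma dim_le_2_if_collinear:
  fixes S :: "'a::euclidean_space set"
  assumes "collinear S"
  shows "dim S \<le> 2"
proof -
  obtain x y where "S \<subseteq> affine hull {x, y}" using assms by (auto simp: collinear_affine_hull)
  then have "S \<subseteq> span {x, y}" using affine_hull_subset_span by blast
  then have "dim S \<le> card {x, y}" by (rule dim_le_card) simp
  also have "\<dots> \<le> 2" by (simp add: card_insert_if)
  finally show ?thesis .
qed

lemma dim_le_2_if_no_adjacent:
  fixes v :: "'i \<Rightarrow> 'a::euclidean_space"
  assumes fin: "finite X" and nonzero: "0 \<notin> v ` X"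
    and no_adjacent: "\<And>a b. a \<in> X \<Longrightarrow> b \<in> X \<Longrightarrow> b \<notin> flat v X {a} \<Longrightarrow> \<not> adjacent v X a b"
  shows "dim (v ` X) \<le> 2"
proof -
  obtain g where "{i \<in> X. v i \<bullet> g = 0} = flat v X {}"
    using exists_generic_annihilator[OF fin] by blast
  then have g: "v i \<bullet> g \<noteq> 0" if "i \<in> X" for i
    using that nonzero by (force simp: flat_def)
  define p where "p i = v i /\<^sub>R (v i \<bullet> g)" for i
  have "collinear (p ` X)"
  proof (rule collinear_if_monochromatic_segments_meet[where colour = "\<lambda>i. v i \<bullet> g > 0", OF fin])
    fix a b assume ab: "a \<in> X" "b \<in> X" "p a \<noteq> p b" "(v a \<bullet> g > 0) = (v b \<bullet> g > 0)"
    have "b \<notin> flat v X {a}"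
    proof
      assume "b \<in> flat v X {a}"
      then obtain t where "v b = t *\<^sub>R v a" by (auto simp: mem_flat span_singleton)
      then show False using ab(3) g[OF ab(2)] by (auto simp: p_def)
    qed
    with no_adjacent[OF ab(1,2)]
    obtain k \<alpha> \<beta> where k: "k \<in> X" "v k = \<alpha> *\<^sub>R v a + \<beta> *\<^sub>R v b" "\<alpha> * \<beta> > 0"
      unfolding adjacent_def by blast
    have "(v a \<bullet> g) * (v b \<bullet> g) > 0"
      using ab(4) g[OF ab(1)] g[OF ab(2)] by (auto simp: zero_less_mult_iff linorder_neq_iff)
    with k ab(3) show "\<exists>k\<in>X. p k \<in> open_segment (p a) (p b)"
      using between_in_open_segment[OF k(2,3)] unfolding p_def by blast
  qed
  then have "dim (p ` X) \<le> 2" by (rule dim_le_2_if_collinear)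
  moreover have "v ` X \<subseteq> span (p ` X)"
  proof clarify
    fix i assume "i \<in> X"
    then have "v i = (v i \<bullet> g) *\<^sub>R p i" using g by (simp add: p_def)
    then show "v i \<in> span (p ` X)" using \<open>i \<in> X\<close> by (metis imageI span_base span_scale)
  qed
  then have "dim (v ` X) \<le> dim (p ` X)" by (metis dim_span dim_subset)
  ultimately show ?thesis by linarith
qed

lemma isgn_dual_functionals_if_adjacent:
  assumes no_antipodal: "antipodal_free v W" and a: "a \<in> W" and b: "b \<in> W"
    and adj: "adjacent v W a b"
    and p: "v a \<bullet> p = 1" "v b \<bullet> p = 0" and q: "v a \<bullet> q = 0" "v b \<bullet> q = 1"
    and i: "i \<in> flat v W {a, b}"
  shows "isgn (v i \<bullet> p) + isgn (v i \<bullet> q) = of_bool (i \<in> flat v W {a}) + of_bool (i \<in> flat v W {b})"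
proof -
  obtain \<alpha> \<beta> where vi: "v i = \<alpha> *\<^sub>R v a + \<beta> *\<^sub>R v b" and iW: "i \<in> W"
    using i by (auto simp: mem_flat mem_span_pair_iff)
  have coordinates: "v i \<bullet> p = \<alpha>" "v i \<bullet> q = \<beta>" using p q by (simp_all add: vi inner_add_left)
  have "i \<in> flat v W {a} \<longleftrightarrow> \<beta> = 0"
    using coordinates(2) q(1) vi iW by (auto simp: mem_flat span_singleton)
  moreover have "i \<in> flat v W {b} \<longleftrightarrow> \<alpha> = 0"
    using coordinates(1) p(2) vi iW by (auto simp: mem_flat span_singleton)
  moreover have "\<alpha> > 0" if "\<beta> = 0" using antipodal_free_pos[OF no_antipodal a iW] vi that by simp
  moreover have "\<beta> > 0" if "\<alpha> = 0" using antipodal_free_pos[OF no_antipodal b iW] vi that by simp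
  moreover have "\<not> \<alpha> * \<beta> > 0" using adj vi iW by (auto simp: adjacent_def)
  ultimately show ?thesis
    unfolding coordinates
    by (cases \<alpha> "0::real" rule: linorder_cases; cases \<beta> "0::real" rule: linorder_cases)
      (auto simp: zero_less_mult_iff)
qed

lemma card_adjacent_points_le:
  assumes fin: "finite W" and no_antipodal: "antipodal_free v W" and a: "a \<in> W" and b: "b \<in> W"
    and ab: "b \<notin> flat v W {a}" and adj: "adjacent v W a b"
  shows "card (flat v W {a}) + card (flat v W {b}) \<le> covector_discrepancy v W"
proof -
  let ?M = "flat v W {a, b}" and ?A = "flat v W {a}" and ?B = "flat v W {b}"
  have "a \<notin> ?B"
    using flat_singleton_eq[of v W a b] ab no_antipodal b subset_flat[of "{b}" W v]
    by (auto simp: antipodal_free_def)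
  then have "v b \<notin> span {v a}" "v a \<notin> span {v b}" using ab a b by (simp_all add: mem_flat)
  then obtain p q where p: "v a \<bullet> p = 1" "v b \<bullet> p = 0" and q: "v a \<bullet> q = 0" "v b \<bullet> q = 1"
    using exists_annihilator[of "v a" "{v b}"] exists_annihilator[of "v b" "{v a}"]
    by (metis insertI1 span_base)
  have points: "?A \<subseteq> ?M" "?B \<subseteq> ?M" by (simp_all add: flat_mono)
  have in_line: "a \<in> ?M" "b \<in> ?M" using subset_flat[of "{a, b}" W v] a b by auto
  have "imbalance v ?M p + imbalance v ?M q = (\<Sum>i\<in>?M. of_bool (i \<in> ?A) + of_bool (i \<in> ?B))"
    unfolding imbalance_def sum.distrib[symmetric]
    by (rule sum.cong) (use isgn_dual_functionals_if_adjacent[OF no_antipodal a b adj p q] in auto)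
  also have "\<dots> = int (card ?A) + int (card ?B)"
    using fin points by (simp add: sum.distrib Int_absorb1 Int_absorb2 Collect_mem_eq)
  finally have "imbalance v ?M p + imbalance v ?M q = int (card ?A) + int (card ?B)" .
  moreover have "\<bar>imbalance v ?M p\<bar> + int (card ?B) \<le> int (covector_discrepancy v ?M)"
    using fin no_antipodal b p(2) in_line
      abs_imbalance_add_covector_discrepancy_flat_le[of ?M "{b}" v p]
    by (simp add: flat_of_flat covector_discrepancy_point)
  moreover have "\<bar>imbalance v ?M q\<bar> + int (card ?A) \<le> int (covector_discrepancy v ?M)"
    using fin no_antipodal a q(1) in_line
      abs_imbalance_add_covector_discrepancy_flat_le[of ?M "{a}" v q]
    by (simp add: flat_of_flat covector_discrepancy_point)
  moreover have "covector_discrepancy v ?M \<le> covector_discrepancy v W"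
    by (rule covector_discrepancy_flat_le[OF fin])
  ultimately show ?thesis by linarith
qed

lemma dim_le_2_if_covector_discrepancy_le_card_points:
  assumes fin: "finite W" and no_antipodal: "antipodal_free v W"
    and discrepancy_le: "\<And>x. x \<in> W \<Longrightarrow> covector_discrepancy v W \<le> card (flat v W {x})"
  shows "dim (v ` W) \<le> 2"
proof (rule dim_le_2_if_no_adjacent[OF fin])
  show "0 \<notin> v ` W" using no_antipodal by (simp add: antipodal_free_def)
  show "\<not> adjacent v W a b" if "a \<in> W" "b \<in> W" "b \<notin> flat v W {a}" for a b
    using card_adjacent_points_le[OF fin no_antipodal that] discrepancy_le[OF that(1)]
      card_point_pos[OF fin that(2), of v] by linarith
qed

lemma dim_le_2_if_covector_discrepancy_le_1:
  assumes fin: "finite W" and no_antipodal: "antipodal_free v W" and "covector_discrepancy v W \<le> 1"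
  shows "dim (v ` W) \<le> 2"
proof (rule dim_le_2_if_covector_discrepancy_le_card_points[OF fin no_antipodal])
  show "covector_discrepancy v W \<le> card (flat v W {x})" if "x \<in> W" for x
    using card_point_pos[OF fin that, of v] assms(3) by linarith
qed

lemma dim_odd_points_le_2:
  assumes fin: "finite W" and nonzero: "0 \<notin> v ` W" and "covector_discrepancy v W \<le> 1"
  shows "dim (v ` {i \<in> W. odd (card (flat v W {i}))}) \<le> 2"
proof -
  obtain K where K: "K \<subseteq> W" "antipodal_free v K"
    "covector_discrepancy v K = covector_discrepancy v W"
    "\<forall>A. even (card (flat v K A)) \<longleftrightarrow> even (card (flat v W A))"
    using exists_antipodal_free_reduction[OF fin nonzero] by blast
  have "{i \<in> W. odd (card (flat v W {i}))} \<subseteq> flat v W K"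
  proof clarify
    fix i assume "odd (card (flat v W {i}))"
    then have "flat v K {i} \<noteq> {}" using K(4) by (metis card.empty even_zero)
    then obtain k where "k \<in> K" "k \<in> flat v W {i}" using K(1) by (fastforce simp: mem_flat)
    assume "i \<in> W"
    then have "i \<in> flat v W {k}"
      using flat_singleton_eq[OF nonzero \<open>k \<in> flat v W {i}\<close>] subset_flat[of "{i}" W v] by simp
    then show "i \<in> flat v W K" using flat_mono[of "{k}" K v W] \<open>k \<in> K\<close> by blast
  qed
  then have "dim (v ` {i \<in> W. odd (card (flat v W {i}))}) \<le> dim (v ` K)"
    by (rule dim_le_if_subset_flat)
  also have "\<dots> \<le> 2"
    by (rule dim_le_2_if_covector_discrepancy_le_1)
      (use K assms(3) fin in \<open>auto intro: finite_subset\<close>)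
  finally show ?thesis .
qed

text \<open>Contract the flat spanned by \<open>A\<close>: the odd points of the contraction span rank at most \<open>2\<close>.\<close>

lemma dim_odd_flats_le:
  fixes v :: "'i \<Rightarrow> 'a::euclidean_space"
  assumes fin: "finite W"
    and discrepancy_le: "covector_discrepancy v W \<le> covector_discrepancy v (flat v W A) + 1"
    and S: "S \<subseteq> W" and odd: "\<And>i. i \<in> S \<Longrightarrow> odd (card (flat v W (insert i A) - flat v W A))"
  shows "dim (v ` (A \<union> S)) \<le> dim (v ` A) + 2"
proof -
  obtain Q :: "'a \<Rightarrow> 'a" where Q: "linear Q" "\<forall>x. Q x = 0 \<longleftrightarrow> x \<in> span (v ` A)"
    by (rule exists_linear_kernel_span)
  let ?W = "W - flat v W A"
  have nonzero: "0 \<notin> (Q \<circ> v) ` ?W"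
    using Q(2) by (auto simp: mem_flat image_iff)
  have "covector_discrepancy (Q \<circ> v) ?W \<le> 1"
    using covector_discrepancy_contraction[OF fin Q] discrepancy_le by linarith
  then have "dim ((Q \<circ> v) ` {i \<in> ?W. odd (card (flat (Q \<circ> v) ?W {i}))}) \<le> 2"
    using nonzero fin by (intro dim_odd_points_le_2) auto
  moreover have "S \<subseteq> {i \<in> ?W. odd (card (flat (Q \<circ> v) ?W {i}))}"
  proof
    fix i assume i: "i \<in> S"
    have "i \<notin> flat v W A"
    proof
      assume "i \<in> flat v W A"
      then have "flat v W (insert i A) = flat v W A"
        by (auto simp: flat_def span_redundant)
      then show False using odd[OF i] by simp
    qed
    then show "i \<in> {i \<in> ?W. odd (card (flat (Q \<circ> v) ?W {i}))}"
      using odd[OF i] i S by (auto simp: flat_contraction[OF Q])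
  qed
  then have "dim ((Q \<circ> v) ` S) \<le> dim ((Q \<circ> v) ` {i \<in> ?W. odd (card (flat (Q \<circ> v) ?W {i}))})"
    by (intro dim_subset image_mono)
  ultimately have "dim (Q ` v ` S) \<le> 2" by (simp add: image_comp)
  moreover have "finite (v ` S)" using S fin by (auto intro: finite_subset)
  ultimately show ?thesis
    using dim_Un_eq_dim_kernel_add_dim_image[OF Q, of "v ` S"] by (simp add: image_Un)
qed

lemma between_coordinate_less:
  fixes x y z g h :: "'a::euclidean_space"
  assumes z: "z = \<alpha> *\<^sub>R x + \<beta> *\<^sub>R y" and pos: "\<alpha> * \<beta> > 0" and same_sign: "(x \<bullet> g) * (y \<bullet> g) > 0"
    and h: "x \<bullet> h = 0" "y \<bullet> h \<noteq> 0"
  shows "z \<bullet> g \<noteq> 0" "z \<bullet> h \<noteq> 0" "\<bar>z \<bullet> h\<bar> / \<bar>z \<bullet> g\<bar> < \<bar>y \<bullet> h\<bar> / \<bar>y \<bullet> g\<bar>"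
proof -
  have \<beta>: "\<beta> \<noteq> 0" and y: "y \<bullet> g \<noteq> 0" using pos same_sign by auto
  have zh: "z \<bullet> h = \<beta> * (y \<bullet> h)" and zg: "z \<bullet> g = \<alpha> * (x \<bullet> g) + \<beta> * (y \<bullet> g)"
    using h(1) by (simp_all add: z inner_add_left)
  have "(\<alpha> * (x \<bullet> g)) * (\<beta> * (y \<bullet> g)) > 0"
    using mult_pos_pos[OF pos same_sign] by (simp add: mult_ac)
  moreover have "\<bar>t\<bar> < \<bar>s + t\<bar>" if "s * t > 0" for s t :: real
    using that by (auto simp: zero_less_mult_iff)
  ultimately have larger: "\<bar>\<beta> * (y \<bullet> g)\<bar> < \<bar>z \<bullet> g\<bar>" unfolding zg by blast
  then show "z \<bullet> g \<noteq> 0" by auto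
  show "z \<bullet> h \<noteq> 0" using zh \<beta> h(2) by simp
  have "\<bar>z \<bullet> h\<bar> / \<bar>z \<bullet> g\<bar> < \<bar>\<beta> * (y \<bullet> h)\<bar> / \<bar>\<beta> * (y \<bullet> g)\<bar>"
    unfolding zh using larger \<beta> y h(2) by (intro divide_strict_left_mono) auto
  then show "\<bar>z \<bullet> h\<bar> / \<bar>z \<bullet> g\<bar> < \<bar>y \<bullet> h\<bar> / \<bar>y \<bullet> g\<bar>" using \<beta> by (simp add: abs_mult)
qed

text \<open>In the chart \<open>g \<noteq> 0\<close> the lines through \<open>x\<close> are parallel, with \<open>h / g\<close> as a coordinate.
  The line through \<open>t\<close> is one closest to the line through \<open>s\<close>.\<close>

lemma exists_adjacent_pencil_line:
  fixes v :: "'i \<Rightarrow> 'a::euclidean_space"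
  assumes fin: "finite X" and x: "v x \<bullet> g = 0" and k: "k \<in> X - flat v X {x, s}" "v k \<bullet> g \<noteq> 0"
  obtains t where "t \<in> X - flat v X {x, s}" "v t \<bullet> g \<noteq> 0"
    "\<forall>s'\<in>flat v X {x, s}. \<forall>t'\<in>flat v X {x, t}. (v s' \<bullet> g) * (v t' \<bullet> g) > 0 \<longrightarrow> adjacent v X s' t'"
proof -
  obtain h where h: "\<forall>i\<in>{x, s}. v i \<bullet> h = 0" "{i \<in> X. v i \<bullet> h = 0} = flat v X {x, s}"
    using exists_generic_annihilator[OF fin] by blast
  define \<tau> where "\<tau> i = \<bar>v i \<bullet> h\<bar> / \<bar>v i \<bullet> g\<bar>" for i
  define K where "K = {i \<in> X - flat v X {x, s}. v i \<bullet> g \<noteq> 0}"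
  have "finite K" "K \<noteq> {}" using fin k by (auto simp: K_def)
  then obtain t where t: "t \<in> K" and minimal: "\<And>i. i \<in> K \<Longrightarrow> \<tau> t \<le> \<tau> i"
    using ex_is_arg_min_if_finite[of K \<tau>] by (auto simp: is_arg_min_linorder)
  have "adjacent v X s' t'"
    if s': "s' \<in> flat v X {x, s}" and t': "t' \<in> flat v X {x, t}"
      and same_sign: "(v s' \<bullet> g) * (v t' \<bullet> g) > 0"
    for s' t'
    unfolding adjacent_def
  proof (intro ballI allI impI notI)
    fix k \<alpha> \<beta> assume k: "k \<in> X" "v k = \<alpha> *\<^sub>R v s' + \<beta> *\<^sub>R v t'" and pos: "\<alpha> * \<beta> > 0"
    obtain \<gamma> \<delta> where "v t' = \<gamma> *\<^sub>R v x + \<delta> *\<^sub>R v t"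
      using t' by (auto simp: mem_flat mem_span_pair_iff)
    then have t'_t: "v t' \<bullet> g = \<delta> * (v t \<bullet> g)" "v t' \<bullet> h = \<delta> * (v t \<bullet> h)"
      using x h(1) by (simp_all add: inner_add_left)
    have "v t \<bullet> h \<noteq> 0" using t h(2) unfolding K_def by blast
    moreover have "\<delta> \<noteq> 0" using same_sign t'_t(1) by auto
    ultimately have "v t' \<bullet> h \<noteq> 0" "\<tau> t' = \<tau> t" using t'_t by (simp_all add: \<tau>_def abs_mult)
    note less = between_coordinate_less[OF k(2) pos same_sign flat_annihilated[OF h(1) s'] this(1)]
    have "k \<in> K" using k(1) h(2) less(1,2) unfolding K_def by blast
    from minimal[OF this] less(3) \<open>\<tau> t' = \<tau> t\<close> show False by (simp add: \<tau>_def)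
  qed
  with t that show ?thesis by (auto simp: K_def)
qed

section \<open>Even and odd lines in configurations of discrepancy at most two\<close>

locale near_balanced =
  fixes v :: "'i \<Rightarrow> 'a::euclidean_space" and W :: "'i set"
  assumes fin: "finite W" and no_antipodal: "antipodal_free v W"
    and discrepancy_le: "covector_discrepancy v W \<le> 2"
begin

abbreviation point :: "'i \<Rightarrow> 'i set" where "point x \<equiv> flat v W {x}"
abbreviation line :: "'i \<Rightarrow> 'i \<Rightarrow> 'i set" where "line x y \<equiv> flat v W {x, y}"
abbreviation plane :: "'i \<Rightarrow> 'i \<Rightarrow> 'i \<Rightarrow> 'i set" where "plane x y z \<equiv> flat v W {x, y, z}"

lemma nonzero: "0 \<notin> v ` W"
  using no_antipodal by (simp add: antipodal_free_def)

lemma mem_point_self: "x \<in> W \<Longrightarrow> x \<in> point x"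
  using subset_flat[of "{x}" W v] by simp

lemma mem_line_left: "x \<in> W \<Longrightarrow> x \<in> line x y"
  and mem_line_right: "y \<in> W \<Longrightarrow> y \<in> line x y"
  by (auto simp: mem_flat span_base)

lemma line_commute: "line x y = line y x"
  by (simp add: insert_commute)

lemma point_subset_line: "point x \<subseteq> line x y"
  by (simp add: flat_mono)

lemma mem_point_commute: "x \<in> W \<Longrightarrow> y \<in> point x \<Longrightarrow> x \<in> point y"
  using flat_singleton_eq[OF nonzero] mem_point_self by blast

lemma line_eq: "z \<in> line x y \<Longrightarrow> z \<notin> point x \<Longrightarrow> line x z = line x y"
  using flat_exchange[of z v W y "{x}"] by (simp add: insert_commute)

lemma line_eq_of_two_points:
  assumes ab: "b \<in> W - point a" and x: "x \<in> line a b" and i: "i \<in> line a b - point x"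
  shows "line x i = line a b"
proof -
  have eq: "line x i = line a b" if c: "x \<notin> point c" "line c d = line a b" for c d
  proof -
    have "line c x = line a b" using line_eq[of x c d] x c by simp
    then have "line x c = line a b" by (simp add: line_commute)
    then show ?thesis using line_eq[of i x c] i by simp
  qed
  have "x \<notin> point a \<or> x \<notin> point b"
    using flat_singleton_eq[OF nonzero] mem_point_self[of b] ab by blast
  then show ?thesis using eq[of a b] eq[of b a] line_commute by blast
qed

lemma lines_meet_in_point:
  assumes ab: "b \<in> W - point a" and y: "y \<in> W - line a b" and z: "z \<in> line a y" "z \<in> line b y"
  shows "z \<in> point y"
proof (rule ccontr)
  assume "z \<notin> point y"
  then have "line a y = line b y"
    using line_eq[of z y a] line_eq[of z y b] z by (simp add: line_commute)
  then have "line a b = line a y" using line_eq[of b a y] ab mem_line_left[of b y] by simp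
  then show False using y mem_line_right[of y a] by simp
qed

lemma dim_image_insert:
  assumes "c \<in> W"
  shows "dim (v ` insert c A) = (if c \<in> flat v W A then dim (v ` A) else dim (v ` A) + 1)"
  using assms by (simp add: dim_insert mem_flat)

lemma dim_line_le_2: "dim (v ` {x, y}) \<le> 2"
  by (simp add: dim_insert)

lemma dim_triple:
  assumes "x \<in> W" "y \<in> W - point x" "z \<in> W - line x y"
  shows "dim (v ` {x, y, z}) = 3"
proof -
  have "x \<notin> flat v W {}" using assms(1) nonzero by (force simp: mem_flat)
  then have "dim (v ` insert z (insert y (insert x {}))) = 3"
    using assms dim_image_insert[of z "{y, x}"] dim_image_insert[of y "{x}"]
      dim_image_insert[of x "{}"]
    by (simp add: line_commute)
  then show ?thesis by (simp add: insert_commute)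
qed

lemma card_line_diff_point: "card (line x y) = card (line x y - point x) + card (point x)"
  using card_Diff_subset[OF _ point_subset_line] card_mono[OF _ point_subset_line] fin by simp

lemma covector_discrepancy_odd_flat:
  assumes "odd (card (flat v W A))"
  shows "covector_discrepancy v (flat v W A) = 1"
proof -
  have "odd (covector_discrepancy v (flat v W A))"
    using even_covector_discrepancy_iff[of "flat v W A" v] assms fin nonzero flat_subset[of v W A]
    by force
  moreover have "covector_discrepancy v (flat v W A) \<le> 2"
    using covector_discrepancy_flat_le[OF fin, of v A] discrepancy_le by linarith
  ultimately show ?thesis by (auto simp: le_Suc_eq numeral_2_eq_2)
qed

lemma abs_imbalance_line_add_card_point_le:
  assumes "x \<in> W" "v x \<bullet> u = 0"
  shows "\<bar>imbalance v (line x y) u\<bar> + int (card (point x))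
    \<le> int (covector_discrepancy v (line x y))"
  using assms fin no_antipodal
    abs_imbalance_add_covector_discrepancy_flat_le[of "line x y" "{x}" v u]
  by (simp add: flat_of_flat mem_line_left covector_discrepancy_point)

lemma
  assumes "x \<in> W" "odd (card (line x y))"
  shows card_point_if_odd_line: "card (point x) = 1"
    and imbalance_odd_line: "v x \<bullet> u = 0 \<Longrightarrow> imbalance v (line x y) u = 0"
  using abs_imbalance_line_add_card_point_le[OF assms(1), of 0 y]
    abs_imbalance_line_add_card_point_le[OF assms(1), of u y]
    covector_discrepancy_odd_flat[OF assms(2)] card_point_pos[OF fin assms(1), of v] by auto

lemma even_flat_if_dim_ge_3:
  assumes "A \<subseteq> W" "dim (v ` A) \<ge> 3"
  shows "even (card (flat v W A))"
proof (rule ccontr)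
  assume "odd (card (flat v W A))"
  then have "dim (v ` flat v W A) \<le> 2"
    using covector_discrepancy_odd_flat fin antipodal_free_subset[OF no_antipodal flat_subset]
    by (intro dim_le_2_if_covector_discrepancy_le_1) auto
  moreover have "dim (v ` A) \<le> dim (v ` flat v W A)"
    by (intro dim_subset image_mono subset_flat assms(1))
  ultimately show False using assms(2) by linarith
qed

lemma even_line_if_adjacent:
  assumes st: "s \<in> W" "t \<in> W - point s" and adj: "adjacent v (line s t) s t"
  shows "even (card (line s t))"
proof (rule ccontr)
  assume "odd (card (line s t))"
  then have "covector_discrepancy v (line s t) = 1" by (rule covector_discrepancy_odd_flat)
  moreover have "s \<in> line s t" "t \<in> line s t" "t \<notin> flat v (line s t) {s}"
    using st by (auto simp: mem_line_left mem_line_right flat_of_flat)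
  ultimately show False
    using card_adjacent_points_le[OF _ antipodal_free_subset[OF no_antipodal flat_subset] _ _ _ adj]
      card_point_pos[of "line s t" s v] card_point_pos[of "line s t" t v] fin by simp
qed

lemma dim_even_lines_le_3:
  assumes x: "x \<in> W" "card (point x) = 1"
    and S: "S \<subseteq> W" "\<And>i. i \<in> S \<Longrightarrow> i \<notin> point x \<and> even (card (line x i))"
  shows "dim (v ` insert x S) \<le> 3"
proof -
  have "dim (v ` ({x} \<union> S)) \<le> dim (v ` {x}) + 2"
  proof (rule dim_odd_flats_le[OF fin _ S(1)])
    show "covector_discrepancy v W \<le> covector_discrepancy v (point x) + 1"
      using covector_discrepancy_point[OF fin no_antipodal x(1)] x(2) discrepancy_le by simp
    show "odd (card (flat v W (insert i {x}) - point x))" if "i \<in> S" for i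
      using S(2)[OF that] card_line_diff_point[of x i] x(2) by (simp add: insert_commute)
  qed
  moreover have "dim (v ` {x}) \<le> 1" by simp
  ultimately show ?thesis by simp
qed

lemma exists_odd_line:
  assumes "dim (v ` W) \<ge> 4"
  shows "\<exists>a\<in>W. \<exists>b\<in>W - point a. odd (card (line a b))"
proof (rule ccontr)
  assume "\<not> ?thesis"
  then have even_lines: "even (card (line x i))" if "x \<in> W" "i \<in> W - point x" for x i
    using that by blast
  have "card (point x) \<noteq> 1" if x: "x \<in> W" for x
  proof
    assume "card (point x) = 1"
    then have "dim (v ` insert x (W - point x)) \<le> 3"
      using even_lines[OF x] by (intro dim_even_lines_le_3[OF x]) auto
    moreover have "W \<subseteq> flat v W (insert x (W - point x))"
      using flat_mono[of "{x}" "insert x (W - point x)" v W]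
        subset_flat[of "insert x (W - point x)" W v] x by blast
    then have "dim (v ` W) \<le> dim (v ` insert x (W - point x))" by (rule dim_le_if_subset_flat)
    ultimately show False using assms by linarith
  qed
  then have "covector_discrepancy v W \<le> card (point x)" if "x \<in> W" for x
    using that card_point_pos[OF fin that, of v] discrepancy_le by fastforce
  then have "dim (v ` W) \<le> 2"
    by (rule dim_le_2_if_covector_discrepancy_le_card_points[OF fin no_antipodal])
  then show False using assms by simp
qed

lemma even_card_flat_diff_point:
  assumes y: "y \<in> flat v W A"
    and even_lines: "\<And>i. i \<in> flat v W A - point y \<Longrightarrow> even (card (line y i - point y))"
  shows "even (card (flat v W A - point y))"
proof -
  define X where "X = flat v W A - point y"
  define \<C> where "\<C> = (\<lambda>i. line y i - point y) ` X"
  have Union: "\<Union>\<C> = X"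
  proof
    have "line y i \<subseteq> flat v W A" if "i \<in> X" for i
      using y that unfolding X_def by (intro flat_minimal) auto
    then show "\<Union>\<C> \<subseteq> X" by (auto simp: \<C>_def X_def)
    show "X \<subseteq> \<Union>\<C>"
    proof
      fix i assume "i \<in> X"
      then have "i \<in> line y i - point y" by (simp add: X_def mem_flat span_base)
      then show "i \<in> \<Union>\<C>" using \<open>i \<in> X\<close> by (auto simp: \<C>_def)
    qed
  qed
  have "2 dvd card (\<Union>\<C>)"
  proof (rule dvd_partition)
    show "finite (\<Union>\<C>)" using Union fin by (simp add: X_def)
    show "\<forall>c\<in>\<C>. 2 dvd card c" using even_lines by (simp add: \<C>_def X_def)
    show "\<forall>c1\<in>\<C>. \<forall>c2\<in>\<C>. c1 \<noteq> c2 \<longrightarrow> c1 \<inter> c2 = {}"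
    proof (intro ballI impI)
      fix c1 c2 assume c: "c1 \<in> \<C>" "c2 \<in> \<C>" "c1 \<noteq> c2"
      then obtain i j where ij: "c1 = line y i - point y" "c2 = line y j - point y"
        by (auto simp: \<C>_def)
      have "line y i = line y j" if "k \<in> c1" "k \<in> c2" for k
        using that ij line_eq[of k y i] line_eq[of k y j] by simp
      with c(3) ij show "c1 \<inter> c2 = {}" by blast
    qed
  qed
  with Union show ?thesis by (simp add: X_def)
qed

lemma exists_even_line:
  assumes A: "A \<subseteq> W" "dim (v ` A) \<ge> 3" and y: "y \<in> flat v W A" "card (point y) = 1"
  shows "\<exists>i\<in>flat v W A - point y. even (card (line y i))"
proof (rule ccontr)
  assume none: "\<not> ?thesis"
  have "even (card (line y i - point y))" if "i \<in> flat v W A - point y" for i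
  proof -
    have "odd (card (line y i))" using none that by blast
    then show ?thesis using card_line_diff_point[of y i] y(2) by simp
  qed
  then have "even (card (flat v W A - point y))" by (rule even_card_flat_diff_point[OF y(1)])
  moreover have "point y \<subseteq> flat v W A" using y(1) by (simp add: flat_minimal)
  then have "card (flat v W A) = card (flat v W A - point y) + card (point y)"
    using fin by (simp add: card_Diff_subset card_mono)
  ultimately show False using even_flat_if_dim_ge_3[OF A] y(2) by simp
qed

text \<open>The plane spanned by \<open>w\<close> and the odd line contains an even line through \<open>y\<close> that leaves \<open>F\<close>.
  Together with two even lines through \<open>y\<close> in \<open>F\<close> it would span rank \<open>4\<close>, but the even lines through
  a point span rank at most \<open>3\<close>.\<close>

lemma even_line_unique_if_odd_line:
  fixes A :: "'i set"
  defines "F \<equiv> flat v W A"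
  assumes w: "w \<in> W - F" and y: "y \<in> F" and l: "l \<in> F - point y" "odd (card (line y l))"
    and i: "i \<in> F - point y" "even (card (line y i))"
    and j: "j \<in> F - point y" "even (card (line y j))"
  shows "j \<in> line y i"
proof (rule ccontr)
  assume nj: "j \<notin> line y i"
  have inW: "y \<in> W" "l \<in> W" "i \<in> W" "j \<in> W"
    using y l i j flat_subset[of v W A] by (auto simp: F_def)
  have card_y: "card (point y) = 1" using card_point_if_odd_line[OF inW(1) l(2)] .
  have yl: "line y l \<subseteq> F" using y l unfolding F_def by (intro flat_minimal) auto
  have "dim (v ` {y, l, w}) = 3" by (rule dim_triple) (use w l inW yl in auto)
  moreover have "y \<in> plane y l w" using inW(1) by (auto simp: mem_flat span_base)
  ultimately obtain m where m: "m \<in> plane y l w - point y" "even (card (line y m))"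
    using exists_even_line[of "{y, l, w}" y] inW w card_y by auto
  have mW: "m \<in> W" using m(1) by (simp add: mem_flat)
  have "m \<notin> line y l" using line_eq[of m y l] m l(2) by auto
  have "m \<notin> F"
  proof
    assume "m \<in> F"
    have "flat v W (insert w {y, l}) = flat v W (insert m {y, l})"
      by (rule flat_exchange[symmetric]) (use m(1) \<open>m \<notin> line y l\<close> in \<open>auto simp: insert_commute\<close>)
    also have "\<dots> \<subseteq> F"
      using \<open>m \<in> F\<close> y l unfolding F_def by (intro flat_minimal) auto
    finally have "flat v W (insert w {y, l}) \<subseteq> F" .
    moreover have "w \<in> flat v W (insert w {y, l})" using w by (simp add: mem_flat span_base)
    ultimately show False using w by blast
  qed
  moreover have "plane y i j \<subseteq> F" using y i j unfolding F_def by (intro flat_minimal) auto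
  ultimately have "dim (v ` insert m {y, i, j}) = dim (v ` {y, i, j}) + 1"
    using dim_image_insert[OF mW, of "{y, i, j}"] by auto
  also have "dim (v ` {y, i, j}) = 3" by (rule dim_triple) (use inW i j nj in auto)
  finally have "dim (v ` insert y {m, i, j}) = 4" by (simp add: insert_commute)
  moreover have "dim (v ` insert y {m, i, j}) \<le> 3"
    by (rule dim_even_lines_le_3[OF inW(1) card_y]) (use inW mW m i j in auto)
  ultimately show False by simp
qed

lemma exists_adjacent_pencil_line_even:
  fixes A :: "'i set"
  defines "F \<equiv> flat v W A"
  assumes x: "x \<in> F" "v x \<bullet> g = 0" and s: "s \<in> F" and k: "k \<in> F - line x s" "v k \<bullet> g \<noteq> 0"
  obtains t where "t \<in> F - line x s" "v t \<bullet> g \<noteq> 0"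
    "\<forall>s'\<in>line x s. \<forall>t'\<in>line x t. (v s' \<bullet> g) * (v t' \<bullet> g) > 0 \<longrightarrow>
      t' \<notin> line x s \<and> even (card (line s' t'))"
proof -
  have finF: "finite F" and FW: "F \<subseteq> W" using fin flat_subset[of v W A] by (simp_all add: F_def)
  have line_F: "flat v F {x, y} = line x y" if "y \<in> F" for y
    using x(1) that unfolding F_def by (intro flat_of_flat) auto
  have "k \<in> F - flat v F {x, s}" using k(1) line_F[OF s] by simp
  from exists_adjacent_pencil_line[where v = v and g = g, OF finF x(2) this k(2)]
  obtain t where t: "t \<in> F - flat v F {x, s}" "v t \<bullet> g \<noteq> 0"
    and adj: "\<forall>s'\<in>flat v F {x, s}. \<forall>t'\<in>flat v F {x, t}.
      (v s' \<bullet> g) * (v t' \<bullet> g) > 0 \<longrightarrow> adjacent v F s' t'" .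
  have "t' \<notin> line x s \<and> even (card (line s' t'))"
    if s': "s' \<in> line x s" and t': "t' \<in> line x t"
      and same_sign: "(v s' \<bullet> g) * (v t' \<bullet> g) > 0" for s' t'
  proof -
    have off_x: "s' \<notin> point x" "t' \<notin> point x"
      using same_sign flat_annihilated[of "{x}" v g _ W] x(2) by auto
    then have lines: "line x s' = line x s" "line x t' = line x t"
      using s' t' by (simp_all add: line_eq)
    have st_W: "s' \<in> W" "t' \<in> W" using s' t' by (simp_all add: mem_flat)
    have "t' \<notin> line x s"
      using line_eq[OF _ off_x(2), of s] lines(2) t(1) line_F[OF s] FW mem_line_right[of t x]
      by auto
    moreover from this have "t' \<notin> point s'"
      using lines(1) point_subset_line[of s' x] by (auto simp: line_commute)
    moreover have "adjacent v (line s' t') s' t'"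
    proof (rule adjacent_subset)
      show "adjacent v F s' t'" using adj s' t' same_sign line_F s t(1) by auto
      have "line x s \<subseteq> F" "line x t \<subseteq> F"
        using x(1) s t(1) unfolding F_def by (simp_all add: flat_minimal)
      then show "line s' t' \<subseteq> F"
        using s' t' unfolding F_def by (intro flat_minimal) auto
    qed
    ultimately show ?thesis using even_line_if_adjacent[of s' t'] st_W by auto
  qed
  moreover have "t \<in> F - line x s" using t(1) line_F[OF s] by simp
  ultimately show ?thesis using that t(2) by blast
qed

end

section \<open>Planes through an odd line\<close>

locale odd_line_in_plane = near_balanced v W
  for v :: "'i \<Rightarrow> 'a::euclidean_space" and W +
  fixes a b f w :: 'i
  assumes a_in_W: "a \<in> W" and b_off_point: "b \<in> W - point a"
    and odd_line_ab: "odd (card (line a b))"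
    and f_off_line: "f \<in> W - line a b" and w_off_plane: "w \<in> W - plane a b f"
begin

abbreviation L :: "'i set" where "L \<equiv> line a b"
abbreviation F :: "'i set" where "F \<equiv> plane a b f"

definition universal :: "'i \<Rightarrow> bool" where
  "universal y \<longleftrightarrow> y \<in> F \<and> (\<forall>k\<in>F - point y. even (card (line y k)))"

lemma in_W: "i \<in> F \<Longrightarrow> i \<in> W"
  by (simp add: mem_flat)

lemma abf_in_F: "a \<in> F" "b \<in> F" "f \<in> F"
  using a_in_W b_off_point f_off_line by (auto simp: mem_flat span_base)

lemma ab_in_L: "a \<in> L" "b \<in> L"
  using a_in_W b_off_point by (auto simp: mem_line_left mem_line_right)

lemma L_subset_F: "L \<subseteq> F"
  by (rule flat_mono) auto

lemma line_subset_F: "x \<in> F \<Longrightarrow> y \<in> F \<Longrightarrow> line x y \<subseteq> F"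
  by (rule flat_minimal) auto

lemma dim_abf: "dim (v ` {a, b, f}) = 3"
  by (rule dim_triple[OF a_in_W b_off_point f_off_line])

lemma notin_point_if_outside_L: "x \<in> L \<Longrightarrow> y \<notin> L \<Longrightarrow> y \<notin> point x"
  using flat_minimal[of "{x}" v W "{a, b}"] by blast

lemma not_universal_if_in_L:
  assumes x: "x \<in> L"
  shows "\<not> universal x"
proof -
  have "a \<notin> point x \<or> b \<notin> point x"
  proof (rule ccontr)
    assume "\<not> ?thesis"
    then have "point a = point x" "b \<in> point x" using flat_singleton_eq[OF nonzero] by simp_all
    then show False using b_off_point by simp
  qed
  with ab_in_L obtain l where "l \<in> L - point x" by fast
  moreover from this have "odd (card (line x l))"
    using odd_line_ab line_eq_of_two_points[OF b_off_point x] by simp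
  ultimately show ?thesis using L_subset_F by (auto simp: universal_def)
qed

lemma exists_odd_line_if_not_universal:
  assumes "e \<in> F" "\<not> universal e"
  obtains l where "l \<in> F - point e" "odd (card (line e l))"
  using assms by (auto simp: universal_def)

lemma card_point_if_not_universal:
  assumes "e \<in> F" "\<not> universal e"
  shows "card (point e) = 1"
  using exists_odd_line_if_not_universal[OF assms] card_point_if_odd_line[OF in_W[OF assms(1)]]
  by metis

lemma even_line_unique_if_not_universal:
  assumes e: "e \<in> F" "\<not> universal e"
    and i: "i \<in> F - point e" "even (card (line e i))"
    and j: "j \<in> F - point e" "even (card (line e j))"
  shows "j \<in> line e i"
  using exists_odd_line_if_not_universal[OF e]
    even_line_unique_if_odd_line[OF w_off_plane e(1) _ _ i j]
  by metis

lemma exists_even_line_through_L: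
  assumes x: "x \<in> L"
  shows "\<exists>s\<in>F - L. even (card (line x s))"
proof -
  have "x \<in> F" "card (point x) = 1"
    using x L_subset_F card_point_if_not_universal not_universal_if_in_L by auto
  moreover have "{a, b, f} \<subseteq> W" using a_in_W b_off_point f_off_line by simp
  ultimately obtain s where s: "s \<in> F - point x" "even (card (line x s))"
    using exists_even_line[of "{a, b, f}" x] dim_abf by auto
  moreover have "s \<notin> L"
    using line_eq_of_two_points[OF b_off_point x, of s] s odd_line_ab by auto
  ultimately show ?thesis by blast
qed

text \<open>Otherwise the line to \<open>x\<close> is the only even line through \<open>s'\<close>. But the neighbouring line of the
  pencil through \<open>x\<close> is odd, hence balanced, so \<open>s'\<close> is adjacent to some point of it.\<close>

lemma universal_on_even_line:
  assumes x: "x \<in> L" and s: "s \<in> F - L" "even (card (line x s))" and k: "k \<in> F - L" "k \<notin> line x s"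
    and s': "s' \<in> line x s - L"
  shows "universal s'"
proof (rule ccontr)
  assume not_universal: "\<not> universal s'"
  have x_F: "x \<in> F" and s'_F: "s' \<in> F" using x s s' L_subset_F line_subset_F by blast+
  obtain g where g: "{i \<in> W. v i \<bullet> g = 0} = L"
    using exists_generic_annihilator[OF fin] by blast
  then have zero_on_L: "v i \<bullet> g = 0 \<longleftrightarrow> i \<in> L" if "i \<in> W" for i using that by blast
  have "v x \<bullet> g = 0" "v k \<bullet> g \<noteq> 0" using zero_on_L x k(1) in_W x_F by auto
  then obtain t where t: "t \<in> F - line x s" "v t \<bullet> g \<noteq> 0"
    and even_across: "\<forall>s'\<in>line x s. \<forall>t'\<in>line x t. (v s' \<bullet> g) * (v t' \<bullet> g) > 0 \<longrightarrow>
      t' \<notin> line x s \<and> even (card (line s' t'))"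
    using exists_adjacent_pencil_line_even[of x "{a, b, f}" g s k] x_F s k by blast
  have "t \<notin> L" using zero_on_L t in_W by blast
  have "odd (card (line x t))"
    using even_line_unique_if_not_universal[OF x_F not_universal_if_in_L[OF x], of s t]
      notin_point_if_outside_L[OF x] s t(1) \<open>t \<notin> L\<close> by blast
  then have "imbalance v (line x t) g = 0"
    using imbalance_odd_line[OF in_W[OF x_F]] \<open>v x \<bullet> g = 0\<close> by blast
  moreover have "v s' \<bullet> g \<noteq> 0" using zero_on_L s' in_W s'_F by blast
  ultimately obtain t' where t': "t' \<in> line x t" "(v s' \<bullet> g) * (v t' \<bullet> g) > 0"
    using exists_same_sign_if_balanced[of "line x t" v g t "v s' \<bullet> g"] fin t
      mem_line_right[OF in_W, of t x] by auto
  then have t'_even: "t' \<notin> line x s" "even (card (line s' t'))" using even_across s' by blast+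
  have "s' \<notin> point x" using notin_point_if_outside_L x s' by blast
  then have line_s': "line s' x = line x s" using line_eq[of s' x s] s' by (simp add: line_commute)
  have "x \<notin> point s'" using mem_point_commute[of s' x] in_W[OF s'_F] \<open>s' \<notin> point x\<close> by blast
  moreover have "t' \<in> F" using t'(1) line_subset_F[OF x_F, of t] t(1) by blast
  moreover have "t' \<notin> point s'" using point_subset_line[of s' x] t'_even(1) line_s' by auto
  ultimately have "t' \<in> line s' x"
    using even_line_unique_if_not_universal[OF s'_F not_universal, of x t'] x_F s(2) line_s'
      t'_even(2)
    by simp
  then show False using t'_even(1) line_s' by simp
qed

lemma universal_unique:
  assumes y: "universal y" and z: "universal z"
  shows "z \<in> point y"
proof -
  have yz: "y \<in> F - L" "z \<in> F - L"
    using y z not_universal_if_in_L by (auto simp: universal_def)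
  have "z \<in> line x y" if x: "x \<in> L" for x
  proof (rule even_line_unique_if_not_universal)
    show "x \<in> F" "\<not> universal x" using x L_subset_F not_universal_if_in_L by auto
    have off: "y \<notin> point x" "z \<notin> point x" using notin_point_if_outside_L x yz by auto
    then show "y \<in> F - point x" "z \<in> F - point x" using yz by auto
    have "x \<notin> point y" "x \<notin> point z" using off mem_point_commute in_W yz by blast+
    then show "even (card (line x y))" "even (card (line x z))"
      using y z x L_subset_F by (auto simp: universal_def line_commute[of x])
  qed
  then show ?thesis
    using lines_meet_in_point[OF b_off_point, of y z] ab_in_L yz in_W by blast
qed

lemma exists_outside_line: "\<exists>r\<in>F. r \<notin> line x y"
proof (rule ccontr)
  assume "\<not> ?thesis"
  then have "{a, b, f} \<subseteq> line x y" using abf_in_F by auto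
  then have "dim (v ` {a, b, f}) \<le> dim (v ` {x, y})" by (rule dim_le_if_subset_flat)
  then show False using dim_abf dim_line_le_2[of x y] by linarith
qed

lemma odd_line_off_universal:
  assumes y: "universal y" and e: "e \<in> F - point y" and t: "t \<in> F - line e y"
  shows "odd (card (line e t))"
proof
  have yF: "y \<in> F" "y \<notin> point e" using y e mem_point_commute[OF in_W] by (auto simp: universal_def)
  have "\<not> universal e" using universal_unique[OF y] e by blast
  moreover have "even (card (line e y))" using y e by (simp add: universal_def line_commute)
  moreover have "t \<notin> point e" using point_subset_line[of e y] t by blast
  moreover assume "even (card (line e t))"
  ultimately have "t \<in> line e y"
    using even_line_unique_if_not_universal[of e y t] e t yF by blast
  then show False using t by simp
qed

text \<open>On \<open>line y k\<close> all vectors off \<open>y\<close> have the same sign: otherwise one of them would be joined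
  by an even line to the neighbouring line of the pencil through \<open>y\<close>.\<close>

lemma card_line_universal:
  assumes y: "universal y" and k: "k \<in> F - point y"
  shows "card (point y) = 1 \<and> card (line y k - point y) = 1"
proof -
  have yF: "y \<in> F" "y \<in> W" using y in_W by (auto simp: universal_def)
  obtain g where g: "\<forall>i\<in>{y}. v i \<bullet> g = 0" "{i \<in> W. v i \<bullet> g = 0} = point y"
    using exists_generic_annihilator[OF fin] by blast
  then have zero_at_y: "v i \<bullet> g = 0 \<longleftrightarrow> i \<in> point y" if "i \<in> W" for i using that by blast
  obtain r where r: "r \<in> F - line y k" using exists_outside_line by blast
  then have "v r \<bullet> g \<noteq> 0" using zero_at_y in_W point_subset_line by blast
  then obtain t where t: "t \<in> F - line y k" "v t \<bullet> g \<noteq> 0"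
    and even_across: "\<forall>e\<in>line y k. \<forall>t'\<in>line y t. (v e \<bullet> g) * (v t' \<bullet> g) > 0 \<longrightarrow>
      t' \<notin> line y k \<and> even (card (line e t'))"
    using exists_adjacent_pencil_line_even[of y "{a, b, f}" g k r] yF(1) k g(1) r by blast
  define P where "P = line y k - point y"
  have opposite_sign: "- (v t \<bullet> g) * (v e \<bullet> g) > 0" if "e \<in> P" for e
  proof -
    have e: "e \<in> line y k" "e \<notin> point y" "e \<in> F"
      using that line_subset_F[OF yF(1), of k] k by (auto simp: P_def)
    then have "line e y = line y k" using line_eq[of e y k] by (simp add: line_commute)
    then have "odd (card (line e t))" using odd_line_off_universal[OF y] e t(1) by simp
    then have "\<not> (v e \<bullet> g) * (v t \<bullet> g) > 0"
      using even_across e(1) mem_line_right[of t y] in_W t(1) by blast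
    moreover have "v e \<bullet> g \<noteq> 0" using zero_at_y e in_W by blast
    ultimately show ?thesis using t(2) by (simp add: less_le mult.commute)
  qed
  have "imbalance v (line y k) g = imbalance v P g"
    using zero_at_y fin by (intro imbalance_mono_neutral) (auto simp: P_def mem_flat)
  then have "\<bar>imbalance v (line y k) g\<bar> = int (card P)"
    using abs_imbalance_eq_card_if_same_sign[OF opposite_sign] by simp
  moreover have "covector_discrepancy v (line y k) \<le> 2"
    using covector_discrepancy_flat_le[OF fin, of v "{y, k}"] discrepancy_le by linarith
  ultimately have "card P + card (point y) \<le> 2"
    using abs_imbalance_line_add_card_point_le[OF yF(2), of g k] g(1) by simp
  moreover have "card P > 0"
    using k fin mem_line_right[of k y] in_W by (auto simp: P_def card_gt_0_iff)
  ultimately show ?thesis using card_point_pos[OF fin yF(2), of v] unfolding P_def by linarith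
qed

lemma point_universal:
  assumes y: "universal y"
  shows "point y = {y}"
proof -
  have yF: "y \<in> F" "y \<notin> L" using y not_universal_if_in_L by (auto simp: universal_def)
  then have "a \<notin> point y"
    using notin_point_if_outside_L[OF ab_in_L(1)] mem_point_commute[OF in_W] by blast
  then have "card (point y) = 1" using card_line_universal[OF y] abf_in_F(1) by blast
  then show ?thesis using mem_point_self[OF in_W[OF yF(1)]] by (metis card_1_singletonE singletonD)
qed

lemma line_universal:
  assumes y: "universal y" and k: "k \<in> F - {y}"
  shows "line y k = {y, k}"
proof -
  have "card (line y k - {y}) = 1"
    using card_line_universal[OF y, of k] k point_universal[OF y] by simp
  then obtain z where "line y k - {y} = {z}" by (rule card_1_singletonE)
  moreover have "k \<in> line y k - {y}" and "y \<in> line y k"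
    using k y in_W by (auto simp: universal_def mem_line_left mem_line_right)
  ultimately show ?thesis by auto
qed

lemma line_off_universal:
  assumes y: "universal y" and c: "c \<in> F - {y}" and d: "d \<in> F - {y}" and nonparallel: "d \<notin> point c"
  shows "y \<notin> line c d" "odd (card (line c d))"
proof -
  have "y \<notin> point c" using mem_point_commute[of c y] in_W c point_universal[OF y] by auto
  moreover have "d \<noteq> c" using nonparallel mem_point_self[OF in_W, of d] d by auto
  then have d_off: "d \<notin> line c y" using line_universal[OF y c] d by (simp add: line_commute)
  ultimately show "y \<notin> line c d" using line_eq[of y c d] mem_line_right[OF in_W, of d c] d by auto
  show "odd (card (line c d))"
    using odd_line_off_universal[OF y, of c d] c d d_off point_universal[OF y] by auto
qed

lemma outside_L_if_universal:
  assumes y: "universal y"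
  shows "F - L = {y}"
proof -
  have yF: "y \<in> F" "y \<notin> L" using y not_universal_if_in_L by (auto simp: universal_def)
  have "dim (v ` (F - {y})) \<le> 2"
  proof (rule dim_le_2_if_no_adjacent)
    show "finite (F - {y})" using fin by simp
    show "0 \<notin> v ` (F - {y})" using nonzero by (auto simp: mem_flat)
    fix c d assume c: "c \<in> F - {y}" and d: "d \<in> F - {y}" and "d \<notin> flat v (F - {y}) {c}"
    then have nonparallel: "d \<notin> point c" by (simp add: mem_flat)
    note odd_line = line_off_universal[OF y c d nonparallel]
    then have "\<not> adjacent v (line c d) c d"
      using even_line_if_adjacent[of c d] in_W c d nonparallel by auto
    moreover have "line c d \<subseteq> F - {y}" using line_subset_F[of c d] c d odd_line(1) by auto
    ultimately show "\<not> adjacent v (F - {y}) c d" by (metis adjacent_subset)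
  qed
  moreover have "3 \<le> dim (v ` (F - {y}))" if z: "z \<in> F - L" "z \<noteq> y" for z
  proof -
    have "dim (v ` {a, b, z}) = 3" using dim_triple[OF a_in_W b_off_point, of z] z in_W by simp
    moreover have "{a, b, z} \<subseteq> F - {y}" using abf_in_F ab_in_L yF z by auto
    ultimately show ?thesis by (metis dim_subset image_mono)
  qed
  ultimately have "F - L \<subseteq> {y}" by fastforce
  with yF show ?thesis by blast
qed

lemma outside_L_eq: "F - L = {f}"
proof -
  have f_outside: "f \<in> F - L" using f_off_line abf_in_F(3) by blast
  have "\<exists>y. F - L = {y}"
  proof (cases "\<exists>y. universal y")
    case True
    then show ?thesis using outside_L_if_universal by blast
  next
    case False
    have "z \<in> line x f" if x: "x \<in> L" and z: "z \<in> F - L" for x z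
    proof -
      obtain s where s: "s \<in> F - L" "even (card (line x s))"
        using exists_even_line_through_L[OF x] by blast
      have in_line: "k \<in> line x s" if "k \<in> F - L" for k
        using universal_on_even_line[OF x s that, of s] False s mem_line_right in_W by blast
      moreover have "f \<notin> point x" using notin_point_if_outside_L x f_off_line by blast
      ultimately have "line x f = line x s" using line_eq f_off_line abf_in_F(3) by blast
      then show ?thesis using in_line[OF z] by simp
    qed
    then have "F - L \<subseteq> point f"
      using lines_meet_in_point[OF b_off_point f_off_line] ab_in_L by blast
    moreover have "card (point f) = 1"
      using card_point_if_not_universal[OF abf_in_F(3)] False by blast
    then obtain y where "point f = {y}" by (rule card_1_singletonE)
    ultimately have "F - L \<subseteq> {y}" by simp
    with f_outside show ?thesis by blast
  qed
  then obtain y where "F - L = {y}" ..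
  with f_outside show ?thesis by simp
qed

lemma even_line_to_outside: "x \<in> L \<Longrightarrow> even (card (line x f))"
  using exists_even_line_through_L outside_L_eq by auto

end

section \<open>Decompositions\<close>

definition has_decomposition :: "('i \<Rightarrow> 'a::euclidean_space) \<Rightarrow> 'i set \<Rightarrow> nat \<Rightarrow> bool" where
  "has_decomposition v W m \<longleftrightarrow> (\<exists>Vs. codeg_star_decomposition v W Vs m)"

lemma has_decomposition_0:
  "codeg_star v W = 0 \<Longrightarrow> has_decomposition v W 0"
  by (auto simp: has_decomposition_def codeg_star_decomposition_def intro: exI[of _ "\<lambda>_. W"])

lemma has_decomposition_Un:
  assumes "has_decomposition v W m" and disjoint: "W \<inter> P = {}"
    and additive: "codeg_star v (W \<union> P) = codeg_star v W + codeg_star v P"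
    and pos: "codeg_star v P \<ge> 1"
  shows "has_decomposition v (W \<union> P) (Suc m)"
proof -
  obtain Vs where Vs: "codeg_star_decomposition v W Vs m"
    using assms(1) by (auto simp: has_decomposition_def)
  let ?V = "Vs(Suc m := P)"
  have upd: "\<And>k. k \<le> m \<Longrightarrow> ?V k = Vs k" "?V (Suc m) = P" by auto
  have parts: "\<forall>k\<le>m. Vs k \<subseteq> W" "(\<Union>k\<le>m. Vs k) = W" "\<forall>k\<le>m. \<forall>l\<le>m. k \<noteq> l \<longrightarrow> Vs k \<inter> Vs l = {}"
    "codeg_star v W = (\<Sum>k=1..m. codeg_star v (Vs k))" "\<forall>k\<in>{1..m}. codeg_star v (Vs k) \<ge> 1"
    using Vs unfolding codeg_star_decomposition_def by auto
  have "(\<Union>k\<le>Suc m. ?V k) = W \<union> P"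
    unfolding atMost_Suc UN_insert upd(2) parts(2)[symmetric] using upd(1) by auto
  moreover have "?V k \<subseteq> W \<union> P" if "k \<le> Suc m" for k
    using that parts(1) by (auto simp: le_Suc_eq)
  moreover have "?V k \<inter> ?V l = {}" if "k \<le> Suc m" "l \<le> Suc m" "k \<noteq> l" for k l
    using that parts(1,3) disjoint
    by (cases "k = Suc m"; cases "l = Suc m") (force simp: le_Suc_eq)+
  moreover have "codeg_star v (W \<union> P) = (\<Sum>k=1..Suc m. codeg_star v (?V k))"
    using parts(4) additive by simp
  moreover have "codeg_star v (?V k) \<ge> 1" if "k \<in> {1..Suc m}" for k
    using that parts(5) pos by auto
  ultimately have "codeg_star_decomposition v (W \<union> P) ?V (Suc m)"
    unfolding codeg_star_decomposition_def by auto
  then show ?thesis by (auto simp: has_decomposition_def)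
qed

lemma codeg_star_empty: "codeg_star v {} = 0"
  using card_eq_codeg_star_covector_discrepancy[of "{}" v] by simp

lemma has_decomposition_1: "codeg_star v W \<ge> 1 \<Longrightarrow> has_decomposition v W 1"
  using has_decomposition_Un[OF has_decomposition_0, of v "{}" W] by (simp add: codeg_star_empty)

lemma codeg_star_pos:
  assumes "finite W" "0 \<notin> v ` W" "covector_discrepancy v W < card W"
  shows "codeg_star v W \<ge> 1"
  using card_eq_codeg_star_covector_discrepancy[OF assms(1,2)] assms(3) by linarith

context near_balanced
begin

lemma dim_le_Suc_covector_discrepancy:
  assumes "dim (v ` W) \<le> 3"
  shows "dim (v ` W) \<le> Suc (covector_discrepancy v W)"
proof (cases "W = {}")
  case False
  then obtain x where x: "x \<in> W" by blast
  have "covector_discrepancy v W \<ge> 1"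
    using covector_discrepancy_flat_le[OF fin, of v "{x}"]
      covector_discrepancy_point[OF fin no_antipodal x]
      card_point_pos[OF fin x, of v] by linarith
  then consider "covector_discrepancy v W = 1" | "covector_discrepancy v W = 2"
    using discrepancy_le by linarith
  then show ?thesis
    using assms dim_le_2_if_covector_discrepancy_le_1[OF fin no_antipodal] by cases auto
qed simp

lemma even_line_off_odd_line:
  assumes dim_W: "dim (v ` W) \<ge> 4" and a: "a \<in> W" and b: "b \<in> W - point a"
    and odd: "odd (card (line a b))" and x: "x \<in> line a b" and z: "z \<in> W - line a b"
  shows "even (card (line x z))"
proof -
  have "\<not> W \<subseteq> plane a b z"
  proof
    assume "W \<subseteq> plane a b z"
    then have "dim (v ` W) \<le> dim (v ` {a, b, z})" by (rule dim_le_if_subset_flat)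
    then show False using dim_W dim_triple[OF a b z] by linarith
  qed
  then obtain w where "w \<in> W - plane a b z" by blast
  then interpret odd_line_in_plane v W a b z w
    using a b odd z by unfold_locales auto
  show ?thesis using even_line_to_outside[OF x] .
qed

lemma dim_outside_odd_line_le_2:
  assumes dim_W: "dim (v ` W) \<ge> 4" and a: "a \<in> W" and b: "b \<in> W - point a"
    and odd: "odd (card (line a b))"
  shows "dim (v ` (W - line a b)) \<le> 2"
proof (rule ccontr)
  let ?Z = "W - line a b"
  assume large: "\<not> dim (v ` ?Z) \<le> 2"
  have card_points: "card (point a) = 1" "card (point b) = 1"
    using card_point_if_odd_line[of a b] card_point_if_odd_line[of b a] a b odd
    by (auto simp: line_commute)
  have dim_insert_le: "dim (v ` insert x ?Z) \<le> 3"
    if x: "x \<in> line a b" "x \<in> W" "card (point x) = 1" for x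
  proof (rule dim_even_lines_le_3[OF x(2,3)])
    show "z \<notin> point x \<and> even (card (line x z))" if "z \<in> ?Z" for z
      using even_line_off_odd_line[OF dim_W a b odd x(1) that]
        flat_minimal[of "{x}" v W "{a, b}"] x(1) that by blast
  qed auto
  have "x \<in> flat v W ?Z" if "x \<in> line a b" "x \<in> W" "card (point x) = 1" for x
    using dim_image_insert[OF that(2), of ?Z] dim_insert_le[OF that] large
    by (simp split: if_splits)
  then have "a \<in> flat v W ?Z" "b \<in> flat v W ?Z"
    using a b card_points by (auto simp: mem_line_left mem_line_right)
  then have "line a b \<subseteq> flat v W ?Z" by (intro flat_minimal) auto
  then have "W \<subseteq> flat v W ?Z" using subset_flat[of ?Z W v] by blast
  then have "dim (v ` W) \<le> dim (v ` ?Z)" by (rule dim_le_if_subset_flat)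
  also have "\<dots> \<le> dim (v ` insert a ?Z)" by (intro dim_subset image_mono) auto
  also have "\<dots> \<le> 3" using a card_points by (intro dim_insert_le) (auto simp: mem_line_left)
  finally show False using dim_W by simp
qed

lemma dim_le_4_and_has_decomposition_2:
  assumes dim_W: "dim (v ` W) \<ge> 4"
  shows "dim (v ` W) \<le> 4 \<and> has_decomposition v W 2"
proof -
  obtain a b where a: "a \<in> W" and b: "b \<in> W - point a" and odd: "odd (card (line a b))"
    using exists_odd_line[OF dim_W] by blast
  define K where "K = line a b"
  define Z where "Z = W - K"
  have W: "W = K \<union> Z" "K \<inter> Z = {}" and fins: "finite K" "finite Z"
    using fin by (auto simp: K_def Z_def mem_flat)
  have "dim (v ` K) \<le> dim (v ` {a, b})"
    by (rule dim_le_if_subset_flat[where W = W]) (simp add: K_def)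
  then have dims: "dim (v ` K) \<le> 2" "dim (v ` Z) \<le> 2"
    using dim_line_le_2[of a b] dim_outside_odd_line_le_2[OF dim_W a b odd]
    by (simp_all add: K_def Z_def)
  have dim_le: "dim (v ` W) \<le> dim (v ` K) + dim (v ` Z)"
    using dim_Un_le[of "v ` Z" "v ` K"] fins by (simp add: W(1) image_Un)
  have additive: "covector_discrepancy v W = covector_discrepancy v K + covector_discrepancy v Z"
    unfolding W(1) by (rule covector_discrepancy_Un_direct[OF fins W(2)])
      (use dims dim_W W(1) in simp)
  have "covector_discrepancy v K = 1"
    using covector_discrepancy_odd_flat odd by (simp add: K_def)
  moreover have "card K \<ge> 2" "card Z \<ge> 2"
    using dims dim_le dim_W dim_le_card'[of "v ` K"] dim_le_card'[of "v ` Z"]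
      card_image_le[OF fins(1), of v] card_image_le[OF fins(2), of v] fins by auto
  moreover have "0 \<notin> v ` K" "0 \<notin> v ` Z" using nonzero W(1) by auto
  ultimately have "codeg_star v K \<ge> 1" "codeg_star v Z \<ge> 1"
    using discrepancy_le additive codeg_star_pos[OF fins(1), of v] codeg_star_pos[OF fins(2), of v]
    by linarith+
  moreover have "codeg_star v (K \<union> Z) = codeg_star v K + codeg_star v Z"
    using additive nonzero unfolding W(1) by (intro codeg_star_Un fins W(2))
  ultimately have "has_decomposition v (K \<union> Z) (Suc 1)"
    by (intro has_decomposition_Un has_decomposition_1 W(2))
  then show ?thesis using dim_le dims W(1) by (simp add: numeral_2_eq_2)
qed

end

lemma exists_decomposition_if_antipodal_free:
  assumes fin: "finite W" and no_antipodal: "antipodal_free v W"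
    and discrepancy_le: "covector_discrepancy v W \<le> 2"
  shows "\<exists>m \<ge> dim (v ` W) - covector_discrepancy v W. has_decomposition v W m"
proof -
  interpret near_balanced v W using assms by unfold_locales
  consider "codeg_star v W = 0" | "codeg_star v W \<ge> 1" "dim (v ` W) \<le> 3" | "dim (v ` W) \<ge> 4"
    by linarith
  then show ?thesis
  proof cases
    assume "codeg_star v W = 0"
    moreover from this have "card W = covector_discrepancy v W"
      using card_eq_codeg_star_covector_discrepancy[OF fin nonzero] by simp
    moreover have "dim (v ` W) \<le> card W"
      using dim_le_card'[of "v ` W"] card_image_le[OF fin, of v] fin
      by (meson finite_imageI order_trans)
    ultimately show ?thesis using has_decomposition_0 by (intro exI[of _ 0]) simp
  next
    assume "codeg_star v W \<ge> 1" "dim (v ` W) \<le> 3"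
    then have "has_decomposition v W 1" "dim (v ` W) \<le> Suc (covector_discrepancy v W)"
      by (simp_all only: has_decomposition_1 dim_le_Suc_covector_discrepancy)
    then show ?thesis by (intro exI[of _ 1]) simp
  next
    assume dim_W: "dim (v ` W) \<ge> 4"
    then have "covector_discrepancy v W = 2"
      using dim_le_2_if_covector_discrepancy_le_1[OF fin no_antipodal] discrepancy_le by linarith
    then show ?thesis
      using dim_le_4_and_has_decomposition_2[OF dim_W] by (intro exI[of _ 2]) auto
  qed
qed

lemma
  assumes "0 \<notin> v ` {i, j}" "antipodal v i j"
  shows covector_discrepancy_antipodal_pair: "covector_discrepancy v {i, j} = 0"
    and codeg_star_antipodal_pair: "codeg_star v {i, j} = 1"
proof -
  show discrepancy_0: "covector_discrepancy v {i, j} = 0"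
    using covector_discrepancy_insert_antipodal_pair[of "{}" v i j] assms by simp
  have "i \<noteq> j" using antipodal_imp_neq assms by force
  then show "codeg_star v {i, j} = 1"
    using card_eq_codeg_star_covector_discrepancy[of "{i, j}" v] assms(1) discrepancy_0 by simp
qed

lemma exists_decomposition_if_covector_discrepancy_le_2:
  assumes "finite W" "0 \<notin> v ` W" "covector_discrepancy v W \<le> 2"
  shows "\<exists>m \<ge> dim (v ` W) - covector_discrepancy v W. has_decomposition v W m"
  using assms
proof (induction rule: antipodal_pair_induct)
  case (antipodal_free W)
  then show ?case by (rule exists_decomposition_if_antipodal_free)
next
  case (antipodal_pair W i j)
  let ?W = "insert i (insert j W)"
  note pair = covector_discrepancy_antipodal_pair[OF _ antipodal_pair.hyps(5)]
    codeg_star_antipodal_pair[OF _ antipodal_pair.hyps(5)]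
  have union: "?W = W \<union> {i, j}" and disjoint: "W \<inter> {i, j} = {}" using antipodal_pair.hyps by auto
  have discrepancy_eq: "covector_discrepancy v ?W = covector_discrepancy v W"
    using antipodal_pair.hyps by (intro covector_discrepancy_insert_antipodal_pair)
  then obtain m where m: "m \<ge> dim (v ` W) - covector_discrepancy v W" "has_decomposition v W m"
    using antipodal_pair.IH antipodal_pair.prems by auto
  have "0 \<notin> v ` (W \<union> {i, j})" using antipodal_pair.hyps(2) unfolding union .
  moreover have "covector_discrepancy v (W \<union> {i, j}) =
      covector_discrepancy v W + covector_discrepancy v {i, j}"
    using discrepancy_eq pair(1) antipodal_pair.hyps(2) unfolding union by simp
  ultimately have "codeg_star v (W \<union> {i, j}) = codeg_star v W + codeg_star v {i, j}"
    using antipodal_pair.hyps(1) disjoint by (intro codeg_star_Un) auto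
  then have "has_decomposition v ?W (Suc m)"
    unfolding union using m(2) disjoint antipodal_pair.hyps(2) pair
    by (intro has_decomposition_Un) auto
  moreover have "dim (v ` ?W) \<le> dim (v ` W) + 1"
  proof -
    have "v j \<in> span (insert (v i) (v ` W))"
      using antipodal_pair.hyps(5)
      by (auto simp: antipodal_def intro!: span_neg span_scale intro: span_base)
    then have "dim (insert (v j) (insert (v i) (v ` W))) \<le> dim (v ` W) + 1"
      by (simp add: dim_insert)
    then show ?thesis by (simp add: insert_commute)
  qed
  ultimately show ?case using m(1) discrepancy_eq by (intro exI[of _ "Suc m"]) auto
qed

theorem mainTheorem2:
  fixes I :: "'i set" and v :: "'i \<Rightarrow> 'a::euclidean_space"
  assumes "finite I"
    and "\<forall>i\<in>I. v i \<noteq> 0"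
    and "covector_discrepancy v I \<le> 2"
  shows "\<exists>m Vs. m \<ge> rank_conf v I - covector_discrepancy v I
                 \<and> codeg_star_decomposition v I Vs m"
proof -
  have "0 \<notin> v ` I" using assms(2) by auto
  then obtain m where "m \<ge> dim (v ` I) - covector_discrepancy v I" "has_decomposition v I m"
    using exists_decomposition_if_covector_discrepancy_le_2 assms(1,3) by blast
  then show ?thesis by (auto simp: has_decomposition_def rank_conf_def)
qed

end
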